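(* Let $\mathcal{M}$ be a model of $I\Delta_0+\Omega_1$, and let $a,b,c\in\mathcal{M}\setminus\{0\}$ be not all of the same sign, square-free and pairwise relatively prime. Then the equation $$ax^2+by^2+cz^2=0$$ has a non-trivial solution in $\mathcal{M}$ (i.e. a solution $(x_0,y_0,z_0)\in\mathcal{M}^3$ with $(x_0,y_0,z_0)\neq(0,0,0)$) if and only if the following three conditions all hold: (1) $-ab\,\mathcal{R}\,c$; (2) $-bc\,\mathcal{R}\,a$; (3) $-ac\,\mathcal{R}\,b$.
   Context: The language of arithmetic is $\{0,1,+,\cdot,\leq\}$. $I\Delta_0$ is the fragment of Peano Arithmetic in which the induction scheme is restricted to $\Delta_0$-formulas, i.e. formulas all of whose quantifiers are bounded by terms of the language (parameters are allowed). $\Omega_1$ is the axiom $\forall x\forall y\exists z\,(x^{\log_2 y}=z)$, where $\log_2 y$ (for $y\geq 1$) denotes the unique $l$ with $2^l\leq y<2^{l+1}$, and exponentiation is expressed through the standard $\Delta_0$-formula defining the graph of exponentiation (which satisfies the usual recursion provably in $I\Delta_0$). $I\Delta_0+\Omega_1$ is the resulting theory. Convention on signs: for a model of $I\Delta_0$ (or $I\Delta_0+\Omega_1$) we also allow negative elements; that is, $\mathcal{M}$ is identified with the discretely ordered ring whose non-negative part is the given model, and all arithmetic takes place in this ring. Divisibility: $x\mid y$ means $y=xz$ for some $z\in\mathcal{M}$. A prime is an element $p>1$ of $\mathcal{M}$ whose only positive divisors are $1$ and $p$. An element $a$ is square-free if there is no prime $p\in\mathcal{M}$ with $p^2\mid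 a$. Elements are relatively prime if their greatest common divisor in $\mathcal{M}$ is $1$. For $a,b\in\mathcal{M}$, $a\,\mathcal{R}\,b$ means that $a$ is a square modulo $b$: there is $x\in\mathcal{M}$ with $b\mid a-x^2$. *)

theory Defs
  imports Main
begin

section \<open>The language of arithmetic and its \<open>\<Delta>\<^sub>0\<close>-formulas\<close>

datatype tm = Var nat | Zero | One | Add tm tm | Mul tm tm

datatype fm =
    Eq tm tm
  | Le tm tm
  | Neg fm
  | Conj fm fm
  | Disj fm fm
  | Impl fm fm
  | All nat fm
  | Ex nat fm

primrec tm_vars :: "tm \<Rightarrow> nat set" where
  "tm_vars (Var i) = {i}"
| "tm_vars Zero = {}"
| "tm_vars One = {}"
| "tm_vars (Add s t) = tm_vars s \<union> tm_vars t"
| "tm_vars (Mul s t) = tm_vars s \<union> tm_vars t"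

text \<open>A bounded quantifier is bounded by a term that does not contain the quantified variable.\<close>

inductive delta0 :: "fm \<Rightarrow> bool" where
  "delta0 (Eq s t)"
| "delta0 (Le s t)"
| "delta0 \<phi> \<Longrightarrow> delta0 (Neg \<phi>)"
| "delta0 \<phi> \<Longrightarrow> delta0 \<psi> \<Longrightarrow> delta0 (Conj \<phi> \<psi>)"
| "delta0 \<phi> \<Longrightarrow> delta0 \<psi> \<Longrightarrow> delta0 (Disj \<phi> \<psi>)"
| "delta0 \<phi> \<Longrightarrow> delta0 \<psi> \<Longrightarrow> delta0 (Impl \<phi> \<psi>)"
| "delta0 \<phi> \<Longrightarrow> n \<notin> tm_vars t \<Longrightarrow> delta0 (All n (Impl (Le (Var n) t) \<phi>))"
| "delta0 \<phi> \<Longrightarrow> n \<notin> tm_vars t \<Longrightarrow> delta0 (Ex n (Conj (Le (Var n) t) \<phi>))"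

text \<open>
  A model is identified with a discretely ordered ring \<open>'a\<close> whose non-negative part is the model
  proper. Formulas are therefore interpreted in the non-negative part of \<open>'a\<close>: the quantifiers
  range over it, and assignments are meant to take values in it.
\<close>

primrec tm_val :: "(nat \<Rightarrow> 'a::linordered_idom) \<Rightarrow> tm \<Rightarrow> 'a" where
  "tm_val e (Var i) = e i"
| "tm_val e Zero = 0"
| "tm_val e One = 1"
| "tm_val e (Add s t) = tm_val e s + tm_val e t"
| "tm_val e (Mul s t) = tm_val e s * tm_val e t"

primrec sat :: "(nat \<Rightarrow> 'a::linordered_idom) \<Rightarrow> fm \<Rightarrow> bool" where
  "sat e (Eq s t) \<longleftrightarrow> tm_val e s = tm_val e t"
| "sat e (Le s t) \<longleftrightarrow> tm_val e s \<le> tm_val e t"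
| "sat e (Neg \<phi>) \<longleftrightarrow> \<not> sat e \<phi>"
| "sat e (Conj \<phi> \<psi>) \<longleftrightarrow> sat e \<phi> \<and> sat e \<psi>"
| "sat e (Disj \<phi> \<psi>) \<longleftrightarrow> sat e \<phi> \<or> sat e \<psi>"
| "sat e (Impl \<phi> \<psi>) \<longleftrightarrow> (sat e \<phi> \<longrightarrow> sat e \<psi>)"
| "sat e (All n \<phi>) \<longleftrightarrow> (\<forall>x\<ge>0. sat (e(n := x)) \<phi>)"
| "sat e (Ex n \<phi>) \<longleftrightarrow> (\<exists>x\<ge>0. sat (e(n := x)) \<phi>)"


section \<open>Models of \<open>I\<Delta>\<^sub>0\<close>\<close>

definition discretely_ordered :: "'a::linordered_idom itself \<Rightarrow> bool" where
  "discretely_ordered _ \<longleftrightarrow> \<not> (\<exists>x::'a. 0 < x \<and> x < 1)"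

text \<open>
  Every instance of the induction scheme, with the variables other than \<open>n\<close> serving as parameters.
\<close>

definition delta0_induction :: "'a::linordered_idom itself \<Rightarrow> bool" where
  "delta0_induction _ \<longleftrightarrow>
     (\<forall>\<phi> n. \<forall>e :: nat \<Rightarrow> 'a. delta0 \<phi> \<longrightarrow> (\<forall>i. 0 \<le> e i) \<longrightarrow>
        sat (e(n := 0)) \<phi> \<longrightarrow>
        (\<forall>x\<ge>0. sat (e(n := x)) \<phi> \<longrightarrow> sat (e(n := x + 1)) \<phi>) \<longrightarrow>
        (\<forall>x\<ge>0. sat (e(n := x)) \<phi>))"

text \<open>
  The models of the basic axioms \<open>PA\<^sup>-\<close> are exactly the non-negative parts of discretely ordered
  commutative rings, so only the discreteness and the induction scheme have to be required.
\<close>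

definition models_IDelta0 :: "'a::linordered_idom itself \<Rightarrow> bool" where
  "models_IDelta0 T \<longleftrightarrow> discretely_ordered T \<and> delta0_induction T"


section \<open>The graph of exponentiation and \<open>\<Omega>\<^sub>1\<close>\<close>

text \<open>
  The relations below are the interpretations, for non-negative arguments, of \<open>\<Delta>\<^sub>0\<close>-formulas:
  all quantifiers are bounded by terms in the arguments.
\<close>

definition pow2 :: "'a::linordered_idom \<Rightarrow> bool" where
  "pow2 p \<longleftrightarrow> 0 < p \<and>
     (\<forall>d\<in>{0..p}. (\<exists>k\<in>{0..p}. d * k = p) \<longrightarrow> d = 1 \<or> (\<exists>k\<in>{0..d}. d = 2 * k))"

text \<open>The binary digit of \<open>m\<close> at the power of two \<open>p\<close> is 1, i.e. \<open>\<lfloor>m/p\<rfloor>\<close> is odd.\<close>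

definition bit_at :: "'a::linordered_idom \<Rightarrow> 'a \<Rightarrow> bool" where
  "bit_at p m \<longleftrightarrow> (\<exists>h\<in>{0..m}. \<exists>r\<in>{0..m}. r < p \<and> m = (2 * h + 1) * p + r)"

text \<open>\<open>v = \<lfloor>s/p\<rfloor> mod p\<close>, i.e. \<open>v\<close> is stored in \<open>s\<close> between the positions \<open>p\<close> and \<open>p\<^sup>2\<close>.\<close>

definition entry_at :: "'a::linordered_idom \<Rightarrow> 'a \<Rightarrow> 'a \<Rightarrow> bool" where
  "entry_at p s v \<longleftrightarrow> 0 \<le> v \<and> v < p \<and>
     (\<exists>h\<in>{0..s}. \<exists>r\<in>{0..s}. r < p \<and> s = (h * p + v) * p + r)"

text \<open>
  \<open>z = x^y\<close> for \<open>x \<ge> 2\<close>, \<open>y \<ge> 1\<close>, by repeated squaring. Let \<open>B\<close> be the power of two with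
  \<open>x < B \<le> 2x\<close>. At the positions \<open>B\<^sup>2, B\<^sup>4, B\<^sup>8, \<dots>, u\<close>, which are marked by binary digits of \<open>m\<close>, the
  numbers \<open>Y\<close> and \<open>Z\<close> store sequences \<open>1 = y\<^sub>1, y\<^sub>2, \<dots>, y\<^sub>k = y\<close> and \<open>x = z\<^sub>1, z\<^sub>2, \<dots>, z\<^sub>k = z\<close> where
  \<open>(y\<^sub>i\<^sub>+\<^sub>1, z\<^sub>i\<^sub>+\<^sub>1)\<close> is \<open>(2y\<^sub>i, z\<^sub>i\<^sup>2)\<close> or \<open>(2y\<^sub>i + 1, z\<^sub>i\<^sup>2 x)\<close>. By induction \<open>z\<^sub>i x\<close> is less than the \<open>i\<close>-th
  position, which in turn is at most \<open>z\<^sub>i\<^sup>4\<close>; hence the entries do not overlap and the codes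
  can be bounded by \<open>z\<^sup>8\<close>.
\<close>

definition exp_code :: "'a::linordered_idom \<Rightarrow> 'a \<Rightarrow> 'a \<Rightarrow> bool" where
  "exp_code x y z \<longleftrightarrow>
     (\<exists>B\<in>{0..2 * x}. pow2 B \<and> x < B \<and>
      (\<exists>u\<in>{0..z ^ 4}. \<exists>m\<in>{0..z ^ 8}. \<exists>Y\<in>{0..z ^ 8}. \<exists>Z\<in>{0..z ^ 8}.
         pow2 u \<and> bit_at u m \<and> entry_at u Y y \<and> entry_at u Z z \<and>
         (\<forall>p\<in>{0..u}. pow2 p \<and> bit_at p m \<longrightarrow>
            p = B ^ 2 \<and> entry_at p Y 1 \<and> entry_at p Z x \<or>
            (\<exists>q\<in>{0..p}. q < p \<and> p = q ^ 2 \<and> pow2 q \<and> bit_at q m \<and>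
               (\<exists>v\<in>{0..Y}. \<exists>w\<in>{0..Z}. entry_at q Y v \<and> entry_at q Z w \<and>
                  (entry_at p Y (2 * v) \<and> entry_at p Z (w ^ 2) \<or>
                   entry_at p Y (2 * v + 1) \<and> entry_at p Z (w ^ 2 * x)))))))"

definition exp_graph :: "'a::linordered_idom \<Rightarrow> 'a \<Rightarrow> 'a \<Rightarrow> bool" where
  "exp_graph x y z \<longleftrightarrow>
     y = 0 \<and> z = 1 \<or>
     1 \<le> y \<and> x = 0 \<and> z = 0 \<or>
     1 \<le> y \<and> x = 1 \<and> z = 1 \<or>
     1 \<le> y \<and> 2 \<le> x \<and> 1 \<le> z \<and> exp_code x y z"

text \<open>\<open>l = log\<^sub>2 y\<close>, i.e. \<open>2^l \<le> y < 2^(l+1)\<close>.\<close>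

definition log2_graph :: "'a::linordered_idom \<Rightarrow> 'a \<Rightarrow> bool" where
  "log2_graph y l \<longleftrightarrow> 0 \<le> l \<and>
     (\<exists>s\<ge>0. exp_graph 2 l s \<and> s \<le> y) \<and> (\<exists>t\<ge>0. exp_graph 2 (l + 1) t \<and> y < t)"

definition Omega1 :: "'a::linordered_idom itself \<Rightarrow> bool" where
  "Omega1 _ \<longleftrightarrow>
     (\<forall>x::'a. \<forall>y::'a. 0 \<le> x \<longrightarrow> 1 \<le> y \<longrightarrow> (\<exists>z\<ge>0. \<exists>l\<ge>0. log2_graph y l \<and> exp_graph x l z))"


section \<open>Arithmetic in the ring\<close>

definition prime_elem_of :: "'a::linordered_idom \<Rightarrow> bool" where
  "prime_elem_of p \<longleftrightarrow> 1 < p \<and> (\<forall>d>0. d dvd p \<longrightarrow> d = 1 \<or> d = p)"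

definition square_free :: "'a::linordered_idom \<Rightarrow> bool" where
  "square_free a \<longleftrightarrow> \<not> (\<exists>p. prime_elem_of p \<and> p ^ 2 dvd a)"

definition is_greatest_common_divisor :: "'a::linordered_idom \<Rightarrow> 'a \<Rightarrow> 'a \<Rightarrow> bool" where
  "is_greatest_common_divisor g a b \<longleftrightarrow>
     g dvd a \<and> g dvd b \<and> (\<forall>d. d dvd a \<longrightarrow> d dvd b \<longrightarrow> d \<le> g)"

definition relatively_prime :: "'a::linordered_idom \<Rightarrow> 'a \<Rightarrow> bool" where
  "relatively_prime a b \<longleftrightarrow> is_greatest_common_divisor 1 a b"

definition square_modulo :: "'a::linordered_idom \<Rightarrow> 'a \<Rightarrow> bool" (infix "\<R>" 50) where
  "a \<R> b \<longleftrightarrow> (\<exists>x. b dvd a - x ^ 2)"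

end

theory Submission
  imports Defs
begin

text \<open>
  Necessity is the usual reduction of a primitive solution modulo \<open>a\<close>, \<open>b\<close> and \<open>c\<close>. For sufficiency let
  \<open>a, b, c > 0\<close> and consider \<open>f = ax\<^sup>2 + by\<^sup>2 - cz\<^sup>2\<close>. The three square roots define a lattice of index
  \<open>N = abc\<close> on which \<open>N\<close> divides \<open>f\<close>. The positive form \<open>ax\<^sup>2 + by\<^sup>2 + 2cz\<^sup>2\<close> has determinant \<open>2N\<^sup>3\<close> on
  this lattice, so by Hermite's bound it takes a value below \<open>2N\<close> at some nonzero lattice vector, where
  \<open>-N < f < 2N\<close>. Hence \<open>f\<close> is \<open>0\<close> or \<open>N\<close>, and the value \<open>N\<close> yields the zero \<open>(xz + by, yz - ax, z\<^sup>2 + ab)\<close>.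
  Hermite's bound needs only the least number principle for \<open>\<Delta>\<^sub>0\<close>-formulas, because the vectors at
  which a positive definite form is small have coordinates bounded by a polynomial in its coefficients.
\<close>

section \<open>Definable predicates and the least number principle\<close>

text \<open>The language has no subtraction, so a polynomial with integer coefficients is
  represented as a difference of two terms; moving the subtracted parts across turns comparisons of
  polynomials into atomic formulas.\<close>

definition ring_term :: "((nat \<Rightarrow> 'a::linordered_idom) \<Rightarrow> 'a) \<Rightarrow> bool" where
  "ring_term f \<longleftrightarrow> (\<exists>s t. \<forall>e. f e = tm_val e s - tm_val e t)"

text \<open>A semantic notion: closure rules derive it from the shape of a HOL predicate, without
  writing down the formula.\<close>

definition definable :: "((nat \<Rightarrow> 'a::linordered_idom) \<Rightarrow> bool) \<Rightarrow> bool" where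
  "definable P \<longleftrightarrow> (\<exists>\<phi>. delta0 \<phi> \<and> (\<forall>e. (\<forall>i. 0 \<le> e i) \<longrightarrow> (sat e \<phi> \<longleftrightarrow> P e)))"

lemma ring_termI: "(\<And>e. f e = tm_val e s - tm_val e t) \<Longrightarrow> ring_term f"
  unfolding ring_term_def by blast

lemma ring_term_var: "ring_term (\<lambda>e. e i)"
  by (rule ring_termI[of _ "Var i" Zero]) simp

lemma ring_term_one: "ring_term (\<lambda>e. 1)"
  by (rule ring_termI[of _ One Zero]) simp

lemma ring_term_add:
  assumes "ring_term f" "ring_term g" shows "ring_term (\<lambda>e. f e + g e)"
proof -
  obtain s t s' t' where "\<And>e. f e = tm_val e s - tm_val e t" "\<And>e. g e = tm_val e s' - tm_val e t'"
    using assms unfolding ring_term_def by blast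
  then show ?thesis
    by (intro ring_termI[of _ "Add s s'" "Add t t'"]) simp
qed

lemma ring_term_diff:
  assumes "ring_term f" "ring_term g" shows "ring_term (\<lambda>e. f e - g e)"
proof -
  obtain s t s' t' where "\<And>e. f e = tm_val e s - tm_val e t" "\<And>e. g e = tm_val e s' - tm_val e t'"
    using assms unfolding ring_term_def by blast
  then show ?thesis
    by (intro ring_termI[of _ "Add s t'" "Add t s'"]) simp
qed

lemma ring_term_mult:
  assumes "ring_term f" "ring_term g" shows "ring_term (\<lambda>e. f e * g e)"
proof -
  obtain s t s' t' where *: "\<And>e. f e = tm_val e s - tm_val e t" "\<And>e. g e = tm_val e s' - tm_val e t'"
    using assms unfolding ring_term_def by blast
  show ?thesis
    by (rule ring_termI[of _ "Add (Mul s s') (Mul t t')" "Add (Mul s t') (Mul t s')"])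
      (unfold * tm_val.simps, algebra)
qed

lemmas ring_term_intros =
  ring_term_var ring_term_one ring_term_add ring_term_diff ring_term_mult

lemma definable_eq:
  assumes "ring_term f" "ring_term g" shows "definable (\<lambda>e. f e = g e)"
proof -
  obtain s t s' t' where *: "\<And>e. f e = tm_val e s - tm_val e t" "\<And>e. g e = tm_val e s' - tm_val e t'"
    using assms unfolding ring_term_def by blast
  have "f e = g e \<longleftrightarrow> sat e (Eq (Add s t') (Add s' t))" for e
    unfolding * by (simp add: diff_eq_eq eq_diff_eq algebra_simps)
  then show ?thesis unfolding definable_def by (blast intro: delta0.intros)
qed

lemma definable_le:
  assumes "ring_term f" "ring_term g" shows "definable (\<lambda>e. f e \<le> g e)"
proof -
  obtain s t s' t' where *: "\<And>e. f e = tm_val e s - tm_val e t" "\<And>e. g e = tm_val e s' - tm_val e t'"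
    using assms unfolding ring_term_def by blast
  have "f e \<le> g e \<longleftrightarrow> sat e (Le (Add s t') (Add s' t))" for e
    unfolding * by (simp add: diff_le_eq le_diff_eq algebra_simps)
  then show ?thesis unfolding definable_def by (blast intro: delta0.intros)
qed

lemma definable_not:
  assumes "definable P" shows "definable (\<lambda>e. \<not> P e)"
proof -
  obtain \<phi> where "delta0 \<phi>" "\<And>e. (\<forall>i. 0 \<le> e i) \<Longrightarrow> sat e \<phi> \<longleftrightarrow> P e"
    using assms unfolding definable_def by blast
  then show ?thesis unfolding definable_def
    by (intro exI[of _ "Neg \<phi>"]) (auto intro: delta0.intros)
qed

lemma definable_less:
  assumes "ring_term f" "ring_term g" shows "definable (\<lambda>e. f e < g e)"
  using definable_not[OF definable_le[OF assms(2,1)]] by (simp add: not_le)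

lemma definable_conj:
  assumes "definable P" "definable Q" shows "definable (\<lambda>e. P e \<and> Q e)"
proof -
  obtain \<phi> \<psi> where "delta0 \<phi>" "\<And>e. (\<forall>i. 0 \<le> e i) \<Longrightarrow> sat e \<phi> \<longleftrightarrow> P e"
      "delta0 \<psi>" "\<And>e. (\<forall>i. 0 \<le> e i) \<Longrightarrow> sat e \<psi> \<longleftrightarrow> Q e"
    using assms unfolding definable_def by blast
  then show ?thesis unfolding definable_def
    by (intro exI[of _ "Conj \<phi> \<psi>"]) (auto intro: delta0.intros)
qed

text \<open>The bound is a single variable; a compound bound is stored in variable \<open>k\<close>
  by the assignment. The condition \<open>n \<noteq> k\<close> is the requirement that a bounding
  term omit the quantified variable.\<close>

lemma definable_bex:
  assumes "definable P" and "n \<noteq> k"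
  shows "definable (\<lambda>e. \<exists>x\<in>{0..e k}. P (e(n := x)))"
proof -
  obtain \<phi> where \<phi>: "delta0 \<phi>" "\<And>e. (\<forall>i. 0 \<le> e i) \<Longrightarrow> sat e \<phi> \<longleftrightarrow> P e"
    using assms unfolding definable_def by blast
  have "delta0 (Ex n (Conj (Le (Var n) (Var k)) \<phi>))"
    using \<phi>(1) assms(2) by (intro delta0.intros) auto
  moreover have "sat e (Ex n (Conj (Le (Var n) (Var k)) \<phi>)) \<longleftrightarrow> (\<exists>x\<in>{0..e k}. P (e(n := x)))"
    if "\<forall>i. 0 \<le> e i" for e
    using assms(2) that \<phi>(2) by auto
  ultimately show ?thesis unfolding definable_def by blast
qed

section \<open>Discreteness and least elements in a model\<close>

locale IDelta0_model =
  fixes ty :: "'a::linordered_idom itself"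
  assumes model: "models_IDelta0 ty"
begin

lemma discrete: "0 < (x::'a) \<Longrightarrow> 1 \<le> x"
  using model unfolding models_IDelta0_def discretely_ordered_def by (meson not_le)

lemma less_iff_add_one_le: "(x::'a) < y \<longleftrightarrow> x + 1 \<le> y"
  using discrete[of "y - x"] by (auto simp: algebra_simps intro: less_le_trans[of x "x + 1"])

text \<open>Variable 1 is reserved for the bound in the induction formula \<open>\<forall>y \<le> x. \<not> P y\<close>.\<close>

lemma least_number:
  fixes e :: "nat \<Rightarrow> 'a"
  assumes "definable P" and ind: "\<And>e x. P (e(1 := x)) \<longleftrightarrow> P e" and e: "\<And>i. 0 \<le> e i"
    and Q: "\<And>x. P (e(0 := x)) \<longleftrightarrow> Q x" and x: "0 \<le> x" "Q x"
  shows "\<exists>m\<ge>0. Q m \<and> (\<forall>y\<ge>0. y < m \<longrightarrow> \<not> Q y)"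
proof (rule ccontr)
  assume "\<not> ?thesis"
  then have no_least: "\<exists>y. 0 \<le> y \<and> y < m \<and> Q y" if "0 \<le> m" "Q m" for m
    using that by blast
  obtain \<phi> where \<phi>: "delta0 \<phi>" "\<And>e. (\<forall>i. 0 \<le> e i) \<Longrightarrow> sat e \<phi> \<longleftrightarrow> P e"
    using assms(1) unfolding definable_def by blast
  define \<psi> where "\<psi> = All 0 (Impl (Le (Var 0) (Var 1)) (Neg \<phi>))"
  have "delta0 \<psi>" unfolding \<psi>_def using \<phi>(1) by (intro delta0.intros) auto
  have sat_\<psi>: "sat (e(1 := z)) \<psi> \<longleftrightarrow> (\<forall>y. 0 \<le> y \<longrightarrow> y \<le> z \<longrightarrow> \<not> Q y)" if "0 \<le> z" for z
  proof -
    have "sat (e(1 := z, 0 := y)) \<phi> \<longleftrightarrow> Q y" if "0 \<le> y" for y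
    proof -
      have "P (e(1 := z, 0 := y)) \<longleftrightarrow> Q y"
        using ind[of "e(0 := y)" z] Q[of y] by (simp add: fun_upd_twist)
      then show ?thesis using that \<open>0 \<le> z\<close> e \<phi>(2)[of "e(1 := z, 0 := y)"] by simp
    qed
    then show ?thesis unfolding \<psi>_def by auto
  qed
  have base: "sat (e(1 := 0)) \<psi>"
    using sat_\<psi> no_least by force
  have step: "sat (e(1 := z + 1)) \<psi>" if "0 \<le> z" "sat (e(1 := z)) \<psi>" for z
  proof -
    have "\<not> Q y" if y: "0 \<le> y" "y \<le> z + 1" for y
    proof
      assume P: "Q y"
      obtain y' where "0 \<le> y'" "y' < y" "Q y'"
        using no_least[OF y(1) P] by blast
      moreover have "y' \<le> z" using \<open>y' < y\<close> y(2) by (simp add: less_iff_add_one_le)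
      ultimately show False using sat_\<psi> \<open>0 \<le> z\<close> \<open>sat (e(1 := z)) \<psi>\<close> by blast
    qed
    then show ?thesis using sat_\<psi> \<open>0 \<le> z\<close> by auto
  qed
  have "\<forall>\<phi> n. \<forall>e::nat \<Rightarrow> 'a. delta0 \<phi> \<longrightarrow> (\<forall>i. 0 \<le> e i) \<longrightarrow> sat (e(n := 0)) \<phi> \<longrightarrow>
        (\<forall>x\<ge>0. sat (e(n := x)) \<phi> \<longrightarrow> sat (e(n := x + 1)) \<phi>) \<longrightarrow> (\<forall>x\<ge>0. sat (e(n := x)) \<phi>)"
    using model unfolding models_IDelta0_def delta0_induction_def by blast
  then have "\<forall>x\<ge>0. sat (e(1 := x)) \<psi>"
    using \<open>delta0 \<psi>\<close> e base step by blast
  then show False using sat_\<psi>[OF x(1)] x by blast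
qed

section \<open>Divisibility\<close>

text \<open>For a non-negative dividend \<open>x\<close> the quotient is the least \<open>q\<close>
  with \<open>x < b * (q + 1)\<close>, and \<open>x\<close> itself is a candidate. A negative
  \<open>a\<close> is handled through \<open>- a - 1\<close>: if this is \<open>b * q + s\<close>,
  then \<open>a = b * (- q - 1) + (b - 1 - s)\<close>.\<close>

lemma division:
  assumes "0 < (b::'a)"
  obtains q r where "a = b * q + r" "0 \<le> r" "r < b"
proof -
  have nonneg: "\<exists>q. b * q \<le> x \<and> x < b * q + b" if "0 \<le> x" for x
  proof -
    have "definable (\<lambda>e::nat \<Rightarrow> 'a. e 2 < e 3 * (e 0 + 1))"
      by (intro definable_less ring_term_intros)
    moreover have "x * 1 \<le> x * b" using assms that discrete by (intro mult_left_mono) auto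
    then have "x < b * (x + 1)" using assms by (simp add: algebra_simps add_le_less_mono)
    ultimately have "\<exists>q\<ge>0. x < b * (q + 1) \<and> (\<forall>y\<ge>0. y < q \<longrightarrow> \<not> x < b * (y + 1))"
      using assms that by (elim least_number[where e = "(\<lambda>_. 0)(2 := x, 3 := b)" and x = x]) auto
    then obtain q where q: "0 \<le> q" "x < b * (q + 1)" "\<And>y. 0 \<le> y \<Longrightarrow> y < q \<Longrightarrow> \<not> x < b * (y + 1)"
      by blast
    have "b * q \<le> x"
    proof (cases "q = 0")
      case False
      then have "0 \<le> q - 1" using q(1) discrete by simp
      with q(3)[of "q - 1"] show ?thesis by (simp add: algebra_simps)
    qed (use that in simp)
    then show ?thesis using q(2) by (intro exI[of _ q]) (simp add: algebra_simps)
  qed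
  show ?thesis
  proof (cases "0 \<le> a")
    case True
    with nonneg obtain q where "b * q \<le> a" "a < b * q + b" by blast
    then show ?thesis by (intro that[of q "a - b * q"]) (auto simp: algebra_simps)
  next
    case False
    with nonneg[of "- a - 1"] discrete[of "- a"] obtain q where "b * q \<le> - a - 1" "- a - 1 < b * q + b"
      by auto
    then have "- a - 1 + 1 \<le> b * q + b" "b * q < - a" by (auto simp: less_iff_add_one_le)
    then show ?thesis
      by (intro that[of "- q - 1" "a - b * (- q - 1)"]) (auto simp: algebra_simps)
  qed
qed

text \<open>The least positive value of \<open>a * u - b * v\<close> is a common divisor. The
  cofactors are confined to \<open>u \<le> b\<close> and \<open>v \<le> a\<close> so that the least
  number principle applies; \<open>le\<close> shows that unrestricted cofactors give no smaller
  positive value.\<close>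

lemma bezout_pos:
  assumes "0 < (a::'a)" "0 < b"
  shows "\<exists>g u v. g = u * a + v * b \<and> g dvd a \<and> g dvd b"
proof -
  have "definable (\<lambda>e::nat \<Rightarrow> 'a. e 0 = e 2 * e 4 - e 3 * e 5)"
    by (intro definable_eq ring_term_intros)
  from definable_bex[OF this, of 5 2]
  have "definable (\<lambda>e::nat \<Rightarrow> 'a. \<exists>v\<in>{0..e 2}. e 0 = e 2 * e 4 - e 3 * v)" by simp
  from definable_bex[OF this, of 4 3]
  have def: "definable (\<lambda>e::nat \<Rightarrow> 'a. 1 \<le> e 0 \<and> (\<exists>u\<in>{0..e 3}. \<exists>v\<in>{0..e 2}. e 0 = e 2 * u - e 3 * v))"
    (is "definable ?P")
    by (intro definable_conj definable_le ring_term_intros) simp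
  let ?e = "(\<lambda>_. 0)(2 := a, 3 := b)"
  let ?Q = "\<lambda>d. 1 \<le> d \<and> (\<exists>u\<in>{0..b}. \<exists>v\<in>{0..a}. d = a * u - b * v)"
  have fresh: "?P (e(1 := x)) \<longleftrightarrow> ?P e" for e x by simp
  have nonneg: "0 \<le> ?e i" for i using assms by simp
  have P_iff_Q: "?P (?e(0 := d)) \<longleftrightarrow> ?Q d" for d by simp
  have "1 \<in> {0..b}" "0 \<in> {0..a}" "1 \<le> a" "a = a * 1 - b * 0"
    using assms discrete by auto
  then have "?Q a" by blast
  have "\<exists>d\<ge>0. ?Q d \<and> (\<forall>y\<ge>0. y < d \<longrightarrow> \<not> ?Q y)"
    by (rule least_number[where P = ?P and e = ?e and Q = ?Q,
          OF def fresh nonneg P_iff_Q less_imp_le[OF assms(1)] \<open>?Q a\<close>])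
  then obtain d u v where "d = a * u - b * v" and "1 \<le> d" and min: "\<forall>y\<ge>0. y < d \<longrightarrow> \<not> ?Q y"
    by blast
  have d_min: "d \<le> r" if "1 \<le> r" "u \<in> {0..b}" "v \<in> {0..a}" "r = a * u - b * v" for r u v
  proof (rule ccontr)
    assume "\<not> d \<le> r"
    then have "r < d" by simp
    moreover have "0 \<le> r" using that(1) by (rule order_trans[OF zero_le_one])
    moreover have "?Q r" using that by blast
    ultimately show False using min by blast
  qed
  have le: "d \<le> r" if r: "0 < r" "r \<le> a" "r = a * U + b * V" for r U V
  proof (rule ccontr)
    assume "\<not> d \<le> r"
    \<comment> \<open>Reducing \<open>U - 1\<close> rather than \<open>U\<close> puts the cofactor
      \<open>u' + 1\<close> between \<open>1\<close> and \<open>b\<close>. The lower bound gives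
      \<open>r \<le> a \<le> a * (u' + 1)\<close>, hence \<open>0 \<le> v'\<close>; the upper one
      gives \<open>v' \<le> a\<close>.\<close>
    obtain q u' where u': "U - 1 = b * q + u'" "0 \<le> u'" "u' < b" using division[OF assms(2)] by metis
    define v' where "v' = - V - a * q"
    have eq: "r = a * (u' + 1) - b * v'"
      using r(3) u'(1) unfolding v'_def by (simp add: algebra_simps eq_diff_eq)
    have "a * 1 \<le> a * (u' + 1)" using assms u' by (intro mult_left_mono) auto
    then have "0 \<le> b * v'" using eq r(2) by simp
    then have "0 \<le> v'" using assms by (simp add: zero_le_mult_iff)
    have "a * (u' + 1) \<le> a * b" using assms u' by (intro mult_left_mono) (auto simp: less_iff_add_one_le)
    then have "b * v' \<le> b * a" using eq r(1) by (simp add: mult.commute)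
    then have "v' \<le> a" using assms by simp
    have "d \<le> r"
    proof (rule d_min)
      show "u' + 1 \<in> {0..b}" using u' by (simp add: less_iff_add_one_le)
      show "v' \<in> {0..a}" using \<open>0 \<le> v'\<close> \<open>v' \<le> a\<close> by simp
    qed (use eq discrete[OF r(1)] in auto)
    then show False using \<open>\<not> d \<le> r\<close> by simp
  qed
  have "d \<le> a" using le[of a 1 0] assms(1) by simp
  have dvd: "d dvd w" if w: "w = a * U + b * V" for w U V
  proof -
    obtain q r where qr: "w = d * q + r" "0 \<le> r" "r < d"
      using division[OF less_le_trans[OF zero_less_one \<open>1 \<le> d\<close>]] by blast
    \<comment> \<open>The remainder is again a value of the linear form and is below
      \<open>d\<close>, so it cannot be positive.\<close>
    have r: "r = a * (U - u * q) + b * (V + v * q)"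
      using qr(1) w \<open>d = a * u - b * v\<close> by algebra
    have "\<not> 0 < r" using le[OF _ _ r] qr(3) \<open>d \<le> a\<close> by linarith
    with qr have "w = d * q" by simp
    then show ?thesis by simp
  qed
  have "d dvd a" "d dvd b" using dvd[of a 1 0] dvd[of b 0 1] by auto
  moreover have "d = u * a + (- v) * b" using \<open>d = a * u - b * v\<close> by algebra
  ultimately show ?thesis by blast
qed

text \<open>For \<open>a = b = 0\<close> the cofactors are \<open>p = 1\<close> and \<open>q = 0\<close>.\<close>

lemma bezout:
  fixes a b :: 'a
  obtains g p q u v where "a = g * p" "b = g * q" "u * p + v * q = 1"
proof (cases "a = 0 \<or> b = 0")
  case True
  then show ?thesis using that[of a 1 0 1 0] that[of b 0 1 0 1] by auto
next
  case False
  obtain g u v where g: "g = u * \<bar>a\<bar> + v * \<bar>b\<bar>" "g dvd a" "g dvd b"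
    using bezout_pos[of "\<bar>a\<bar>" "\<bar>b\<bar>"] False unfolding dvd_abs_iff zero_less_abs_iff by blast
  obtain p q where pq: "a = g * p" "b = g * q" using g(2,3) unfolding dvd_def by blast
  have "\<bar>a\<bar> = sgn a * (g * p)" "\<bar>b\<bar> = sgn b * (g * q)"
    using pq abs_sgn[of a] abs_sgn[of b] by (simp_all only: mult.commute)
  with g(1) have "g * (u * sgn a * p + v * sgn b * q) = g * 1" by algebra
  moreover have "g \<noteq> 0" using False pq(1) by auto
  ultimately have "u * sgn a * p + v * sgn b * q = 1" by (metis mult_left_cancel)
  with pq show ?thesis using that by blast
qed

text \<open>Division of \<open>2 * N + m\<close> by \<open>2 * m\<close> rounds \<open>N / m\<close>
  to a nearest integer, leaving \<open>2 * (N - m * q) = r - m\<close>. The squared form suits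
  estimates after completing a square.\<close>

lemma nearest_multiple:
  assumes "0 < (m::'a)"
  obtains k where "(2 * (N + m * k))\<^sup>2 \<le> m\<^sup>2"
proof -
  obtain q r where qr: "2 * N + m = 2 * m * q + r" "0 \<le> r" "r < 2 * m"
    using division[of "2 * m" "2 * N + m"] assms by auto
  then have "2 * (N + m * - q) = r - m" by (simp add: algebra_simps)
  moreover have "\<bar>r - m\<bar> \<le> \<bar>m\<bar>" using qr by auto
  ultimately show ?thesis using that[of "- q"] by (simp only: abs_le_square_iff)
qed

end

section \<open>Minima of quadratic forms\<close>

text \<open>\<open>A, B, C\<close> are the diagonal and \<open>D, E, H\<close> the off-diagonal
  entries of a symmetric matrix, whose determinant is \<open>qdet\<close>. Binary forms appear as
  \<open>qform A B 0 D 0 0 x y 0\<close>.\<close>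

definition qform :: "'a::linordered_idom \<Rightarrow> 'a \<Rightarrow> 'a \<Rightarrow> 'a \<Rightarrow> 'a \<Rightarrow> 'a \<Rightarrow> 'a \<Rightarrow> 'a \<Rightarrow> 'a \<Rightarrow> 'a" where
  "qform A B C D E H x y z =
     A * x\<^sup>2 + B * y\<^sup>2 + C * z\<^sup>2 + 2 * D * x * y + 2 * E * x * z + 2 * H * y * z"

definition qdet :: "'a::linordered_idom \<Rightarrow> 'a \<Rightarrow> 'a \<Rightarrow> 'a \<Rightarrow> 'a \<Rightarrow> 'a \<Rightarrow> 'a" where
  "qdet A B C D E H = A * B * C + 2 * D * E * H - A * H\<^sup>2 - B * E\<^sup>2 - C * D\<^sup>2"

lemma qform_swap: "qform A B C D E H x y z = qform A C B E D H x z y"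
  unfolding qform_def by (simp add: algebra_simps)

lemma qdet_swap: "qdet A B C D E H = qdet A C B E D H"
  unfolding qdet_def by (simp add: algebra_simps)

lemma qform_scale: "qform A B C D E H (h * x) (h * y) (h * z) = h\<^sup>2 * qform A B C D E H x y z"
  unfolding qform_def by (simp add: algebra_simps power2_eq_square)

lemma ring_term_qform:
  assumes "ring_term A" "ring_term B" "ring_term C" "ring_term D" "ring_term E" "ring_term H"
    and "ring_term x" "ring_term y" "ring_term z"
  shows "ring_term (\<lambda>e. qform (A e) (B e) (C e) (D e) (E e) (H e) (x e) (y e) (z e))"
  unfolding qform_def power2_eq_square mult_2 by (intro ring_term_intros assms)

text \<open>Change of basis in the first two variables, with columns \<open>(p, q)\<close> and
  \<open>(- v, u)\<close>. It is unimodular when \<open>u * p + v * q = 1\<close>, and it makes the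
  value at \<open>(p, q, 0)\<close> the leading coefficient.\<close>

lemma qform_substitution:
  fixes A :: "'a::linordered_idom"
  obtains B' D' E' H' where
    "\<And>x y z. qform (A * p\<^sup>2 + B * q\<^sup>2 + 2 * D * p * q) B' C D' E' H' x y z =
       qform A B C D E H (p * x - v * y) (q * x + u * y) z"
    "qdet (A * p\<^sup>2 + B * q\<^sup>2 + 2 * D * p * q) B' C D' E' H' = qdet A B C D E H * (u * p + v * q)\<^sup>2"
proof
  let ?B = "A * v\<^sup>2 + B * u\<^sup>2 - 2 * D * u * v" and ?D = "B * q * u - A * p * v + D * (p * u - q * v)"
  let ?E = "E * p + H * q" and ?H = "H * u - E * v"
  show "qform (A * p\<^sup>2 + B * q\<^sup>2 + 2 * D * p * q) ?B C ?D ?E ?H x y z =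
       qform A B C D E H (p * x - v * y) (q * x + u * y) z" for x y z
    unfolding qform_def by (simp add: algebra_simps power2_eq_square)
  show "qdet (A * p\<^sup>2 + B * q\<^sup>2 + 2 * D * p * q) ?B C ?D ?E ?H = qdet A B C D E H * (u * p + v * q)\<^sup>2"
    unfolding qdet_def by algebra
qed

context IDelta0_model
begin

text \<open>
  Variables of \<open>\<Delta>\<^sub>0\<close>-formulas are non-negative, so the coordinates are shifted by \<open>K\<close> and each coefficient
  \<open>A\<close> is stored as the difference of \<open>\<bar>A\<bar> + A\<close> and \<open>\<bar>A\<bar>\<close>.
\<close>

lemma box_minimum:
  fixes A B C D E H :: 'a
  assumes "x0 \<in> {-K..K}" "y0 \<in> {-K..K}" "z0 \<in> {-K..K}" and pos: "0 < qform A B C D E H x0 y0 z0"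
  obtains x y z where "0 < qform A B C D E H x y z"
    "\<And>x' y' z'. x' \<in> {-K..K} \<Longrightarrow> y' \<in> {-K..K} \<Longrightarrow> z' \<in> {-K..K} \<Longrightarrow> 0 < qform A B C D E H x' y' z' \<Longrightarrow>
       qform A B C D E H x y z \<le> qform A B C D E H x' y' z'"
proof -
  let ?g = "\<lambda>e x y z. qform (e 10 - e 11) (e 12 - e 13) (e 14 - e 15) (e 16 - e 17) (e 18 - e 19)
      (e 20 - e 21) (x - e 3) (y - e 3) (z - e 3)"
  let ?e = "(\<lambda>_. 0)(2 := K + K, 3 := K, 10 := \<bar>A\<bar> + A, 11 := \<bar>A\<bar>, 12 := \<bar>B\<bar> + B, 13 := \<bar>B\<bar>,
      14 := \<bar>C\<bar> + C, 15 := \<bar>C\<bar>, 16 := \<bar>D\<bar> + D, 17 := \<bar>D\<bar>, 18 := \<bar>E\<bar> + E, 19 := \<bar>E\<bar>,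
      20 := \<bar>H\<bar> + H, 21 := \<bar>H\<bar>)"
  let ?q = "qform A B C D E H"
  let ?Q = "\<lambda>m. 1 \<le> m \<and> (\<exists>x\<in>{0..K+K}. \<exists>y\<in>{0..K+K}. \<exists>z\<in>{0..K+K}. m = ?q (x - K) (y - K) (z - K))"
  have "definable (\<lambda>e::nat \<Rightarrow> 'a. e 0 = ?g e (e 4) (e 5) (e 6))"
    by (intro definable_eq ring_term_qform ring_term_intros)
  from definable_bex[OF this, of 6 2]
  have "definable (\<lambda>e::nat \<Rightarrow> 'a. \<exists>z\<in>{0..e 2}. e 0 = ?g e (e 4) (e 5) z)" by simp
  from definable_bex[OF this, of 5 2]
  have "definable (\<lambda>e::nat \<Rightarrow> 'a. \<exists>y\<in>{0..e 2}. \<exists>z\<in>{0..e 2}. e 0 = ?g e (e 4) y z)" by simp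
  from definable_bex[OF this, of 4 2]
  have def: "definable (\<lambda>e::nat \<Rightarrow> 'a. 1 \<le> e 0 \<and>
      (\<exists>x\<in>{0..e 2}. \<exists>y\<in>{0..e 2}. \<exists>z\<in>{0..e 2}. e 0 = ?g e x y z))" (is "definable ?P")
    by (intro definable_conj definable_le ring_term_intros) simp
  have fresh: "?P (e(1 := x)) \<longleftrightarrow> ?P e" for e x by simp
  have nonneg: "0 \<le> ?e i" for i
  proof -
    have "0 \<le> \<bar>w\<bar> + w" for w :: 'a using abs_ge_minus_self[of w] by (simp add: algebra_simps)
    then show ?thesis using assms(1) by simp
  qed
  have P_iff_Q: "?P (?e(0 := m)) \<longleftrightarrow> ?Q m" for m by simp
  have Q: "?Q (?q x y z)" if "x \<in> {-K..K}" "y \<in> {-K..K}" "z \<in> {-K..K}" "0 < ?q x y z" for x y z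
  proof -
    have "w + K \<in> {0..K+K}" if "w \<in> {-K..K}" for w
      using that add_right_mono[of "- K" w K] add_right_mono[of w K K] by simp
    then have "x + K \<in> {0..K+K}" "y + K \<in> {0..K+K}" "z + K \<in> {0..K+K}"
      using that(1-3) by blast+
    moreover have "?q x y z = ?q (x + K - K) (y + K - K) (z + K - K)" by simp
    ultimately show ?thesis using discrete[OF that(4)] by blast
  qed
  have "\<exists>m\<ge>0. ?Q m \<and> (\<forall>y\<ge>0. y < m \<longrightarrow> \<not> ?Q y)"
    by (rule least_number[where P = ?P and e = ?e and Q = ?Q,
          OF def fresh nonneg P_iff_Q less_imp_le[OF pos] Q[OF assms]])
  then obtain x y z where "1 \<le> ?q x y z" and min: "\<forall>w\<ge>0. w < ?q x y z \<longrightarrow> \<not> ?Q w"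
    by blast
  moreover have "?q x y z \<le> ?q x' y' z'"
    if "x' \<in> {-K..K}" "y' \<in> {-K..K}" "z' \<in> {-K..K}" "0 < ?q x' y' z'" for x' y' z'
    using min Q[OF that] that(4) by (meson not_le less_imp_le)
  ultimately show ?thesis
    by (intro that[of x y z]) (auto intro: less_le_trans[OF zero_less_one])
qed

section \<open>Hermite's bound for binary forms\<close>

text \<open>Multiplying the form by \<open>A\<close> and completing the square leaves
  \<open>(A * x + D * y)^2 + (A * B - D^2) * y^2\<close>, where \<open>A * B - D^2\<close> is at
  least 1 by discreteness. The same holds with \<open>B\<close> and \<open>x\<close>.\<close>

lemma binary_bounds:
  assumes A: "0 < (A::'a)" and det: "0 < A * B - D\<^sup>2"
  shows "0 < B"
    and "y\<^sup>2 \<le> A * qform A B 0 D 0 0 x y 0"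
    and "x\<^sup>2 \<le> B * qform A B 0 D 0 0 x y 0"
    and "(x, y) \<noteq> (0, 0) \<Longrightarrow> 0 < qform A B 0 D 0 0 x y 0"
proof -
  let ?q = "\<lambda>x y. qform A B 0 D 0 0 x y 0"
  have "0 < A * B" using det zero_le_power2[of D] by linarith
  then show B: "0 < B" using A by (simp add: zero_less_mult_iff)
  have Aq: "A * ?q x y = (A * x + D * y)\<^sup>2 + (A * B - D\<^sup>2) * y\<^sup>2" for x y
    unfolding qform_def by algebra
  have Bq: "B * ?q x y = (B * y + D * x)\<^sup>2 + (A * B - D\<^sup>2) * x\<^sup>2" for x y
    unfolding qform_def by algebra
  show y_le: "y\<^sup>2 \<le> A * ?q x y" for x y
    using mult_right_mono[OF discrete[OF det] zero_le_power2[of y]] unfolding Aq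
    by (simp add: add_increasing)
  show x_le: "x\<^sup>2 \<le> B * ?q x y" for x y
    using mult_right_mono[OF discrete[OF det] zero_le_power2[of x]] unfolding Bq
    by (simp add: add_increasing)
  show "0 < ?q x y" if "(x, y) \<noteq> (0, 0)" for x y
  proof (cases "x = 0")
    case True
    then have "0 < A * ?q x y" using that less_le_trans[OF _ y_le] by simp
    then show ?thesis using A by (simp add: zero_less_mult_iff)
  next
    case False
    then have "0 < B * ?q x y" using less_le_trans[OF _ x_le] by simp
    then show ?thesis using B by (simp add: zero_less_mult_iff)
  qed
qed

text \<open>Take a basis whose first vector attains the minimum \<open>m\<close> and whose middle
  coefficient \<open>M\<close> satisfies \<open>|2 M| \<le> m\<close>. The second vector has a value
  \<open>n \<ge> m\<close>, so \<open>m^2 \<le> m * n = (A * B - D^2) + M^2\<close> with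
  \<open>M^2 \<le> m^2 / 4\<close>.\<close>

lemma binary_minimum:
  assumes A: "0 < (A::'a)" and det: "0 < A * B - D\<^sup>2"
  obtains x y where "(x, y) \<noteq> (0, 0)"
    "3 * (qform A B 0 D 0 0 x y 0)\<^sup>2 \<le> 4 * (A * B - D\<^sup>2)" "0 < qform A B 0 D 0 0 x y 0"
proof -
  let ?q = "\<lambda>x y. qform A B 0 D 0 0 x y 0"
  note bounds = binary_bounds[OF A det]
  note B = bounds(1) and y_le = bounds(2) and x_le = bounds(3) and pos = bounds(4)
  \<comment> \<open>A vector of value at most \<open>A\<close> has \<open>x^2 \<le> B * A\<close>
    and \<open>y^2 \<le> A * A\<close>, so it lies in this box. Since \<open>(1, 0)\<close> has
    value \<open>A\<close>, the minimum over the box is global.\<close>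
  let ?K = "A + B"
  have K: "1 \<le> ?K" "A \<le> ?K" "B \<le> ?K" "0 \<le> ?K" using A B discrete[OF A] by auto
  have q10: "?q 1 0 = A" unfolding qform_def by simp
  then have q10_pos: "0 < ?q 1 0" using A by simp
  have one_in: "1 \<in> {-?K..?K}" and zero_in: "0 \<in> {-?K..?K}"
    using K(1,4) order_trans[of "- ?K" 0 1] by auto
  obtain x y z where xyz: "0 < qform A B 0 D 0 0 x y z" and
    min: "\<And>x' y' z'. x' \<in> {-?K..?K} \<Longrightarrow> y' \<in> {-?K..?K} \<Longrightarrow> z' \<in> {-?K..?K} \<Longrightarrow>
      0 < qform A B 0 D 0 0 x' y' z' \<Longrightarrow> qform A B 0 D 0 0 x y z \<le> qform A B 0 D 0 0 x' y' z'"
    by (rule box_minimum[OF one_in zero_in zero_in q10_pos]) blast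
  have no_z: "qform A B 0 D 0 0 x y z = ?q x y" unfolding qform_def by simp
  have in_box: "w \<in> {-?K..?K}" if "w\<^sup>2 \<le> ?K * A" for w
  proof -
    have "w\<^sup>2 \<le> ?K\<^sup>2"
      using that mult_left_mono[OF K(2,4)] by (simp add: power2_eq_square)
    then have "\<bar>w\<bar> \<le> ?K" using K(4) by (simp add: abs_le_square_iff[symmetric])
    then show ?thesis by auto
  qed
  have min_all: "?q x y \<le> ?q x' y'" if nz: "(x', y') \<noteq> (0, 0)" for x' y'
  proof (cases "?q x' y' \<le> A")
    case True
    note q = pos[OF nz]
    have "x'\<^sup>2 \<le> ?K * A"
      by (rule order_trans[OF x_le mult_mono[OF K(3) True K(4) less_imp_le[OF q]]])
    moreover have "y'\<^sup>2 \<le> ?K * A"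
      by (rule order_trans[OF y_le mult_mono[OF K(2) True K(4) less_imp_le[OF q]]])
    ultimately show ?thesis
      using min[OF in_box in_box zero_in q] unfolding no_z by blast
  next
    case False
    have "?q x y \<le> ?q 1 0" using min[OF one_in zero_in zero_in q10_pos] unfolding no_z by simp
    then show ?thesis using False q10 by simp
  qed
  have xy: "0 < ?q x y" using xyz unfolding no_z .
  \<comment> \<open>The value at the primitive part \<open>(p, q)\<close> is smaller by the factor
    \<open>g^2\<close>, so \<open>(p, q)\<close> is a minimizer too; \<open>(- v, u)\<close>
    completes it to a basis.\<close>
  obtain g p q u v where b: "x = g * p" "y = g * q" "u * p + v * q = 1" using bezout[of x y] by metis
  have "(p, q) \<noteq> (0, 0)" using b(3) by auto
  define m where "m = ?q p q"
  have m: "0 < m" unfolding m_def using pos \<open>(p, q) \<noteq> (0, 0)\<close> by blast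
  have "g \<noteq> 0" using xy b unfolding qform_def by auto
  have "?q x y = g\<^sup>2 * m" unfolding m_def b qform_def by algebra
  moreover have "1 \<le> g\<^sup>2" using \<open>g \<noteq> 0\<close> discrete[of "g\<^sup>2"] by simp
  ultimately have "m \<le> ?q x y" using m mult_right_mono[of 1 "g\<^sup>2" m] by simp
  then have m_min: "m \<le> ?q x' y'" if "(x', y') \<noteq> (0, 0)" for x' y'
    using min_all[OF that] by simp
  \<comment> \<open>The middle coefficient in the basis \<open>(p, q)\<close>,
    \<open>(- v, u)\<close>. Adding \<open>k\<close> times the first vector to the second turns it
    into \<open>N + m * k\<close>.\<close>
  define N where "N = B * q * u - A * p * v + D * (p * u - q * v)"
  obtain k where k: "(2 * (N + m * k))\<^sup>2 \<le> m\<^sup>2" using nearest_multiple[OF m] by blast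
  let ?s = "- v + k * p" and ?t = "u + k * q"
  have "p * ?t - q * ?s = 1" using b(3) by (simp add: algebra_simps)
  then have "(?s, ?t) \<noteq> (0, 0)" by auto
  then have "m \<le> ?q ?s ?t" by (rule m_min)
  then have "m * m \<le> m * ?q ?s ?t" using m by (intro mult_left_mono) auto
  moreover have "m * ?q ?s ?t - (N + m * k)\<^sup>2 = (A * B - D\<^sup>2) * (u * p + v * q)\<^sup>2"
    unfolding m_def N_def qform_def by algebra
  then have "m * ?q ?s ?t = (A * B - D\<^sup>2) + (N + m * k)\<^sup>2" unfolding b(3) by (simp add: algebra_simps)
  ultimately have "3 * m\<^sup>2 \<le> 4 * (A * B - D\<^sup>2)"
    using k by (simp add: power2_eq_square algebra_simps)
  then show ?thesis using that[of p q] m \<open>(p, q) \<noteq> (0, 0)\<close> unfolding m_def by blast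
qed

section \<open>Hermite's bound for ternary forms\<close>

text \<open>\<open>A * f\<close> is the square of \<open>A * x + D * y + E * z\<close> plus a
  positive definite binary form in \<open>y, z\<close>. Where \<open>f \<le> A\<close>, the binary
  form bounds \<open>y\<close> and \<open>z\<close>, and then the square bounds \<open>x\<close>.
  Since \<open>A\<close> is the value at \<open>(1, 0, 0)\<close>, a minimum over the resulting box
  is global.\<close>

lemma ternary_attained_minimum:
  assumes A: "0 < (A::'a)" and minor: "0 < A * B - D\<^sup>2" and det: "0 < qdet A B C D E H"
  obtains x y z where "(x, y, z) \<noteq> (0, 0, 0)"
    "\<And>x' y' z'. (x', y', z') \<noteq> (0, 0, 0) \<Longrightarrow>
       0 < qform A B C D E H x' y' z' \<and> qform A B C D E H x y z \<le> qform A B C D E H x' y' z'"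
proof -
  let ?f = "qform A B C D E H"
  define \<alpha> where "\<alpha> = A * B - D\<^sup>2"
  define \<beta> where "\<beta> = A * H - D * E"
  define \<gamma> where "\<gamma> = A * C - E\<^sup>2"
  let ?q = "\<lambda>y z. qform \<alpha> \<gamma> 0 \<beta> 0 0 y z 0"
  have Af: "A * ?f x y z = (A * x + D * y + E * z)\<^sup>2 + ?q y z" for x y z
    unfolding qform_def \<alpha>_def \<beta>_def \<gamma>_def by algebra
  have \<alpha>: "0 < \<alpha>" using minor unfolding \<alpha>_def .
  have "\<alpha> * \<gamma> - \<beta>\<^sup>2 = A * qdet A B C D E H"
    unfolding \<alpha>_def \<beta>_def \<gamma>_def qdet_def by algebra
  then have det_q: "0 < \<alpha> * \<gamma> - \<beta>\<^sup>2" using A det by simp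
  note bounds = binary_bounds[OF \<alpha> det_q]
  note \<gamma> = bounds(1)
  have q_nonneg: "0 \<le> ?q y z" for y z
  proof (cases "(y, z) = (0, 0)")
    case True
    then show ?thesis by (simp add: qform_def)
  next
    case False
    then show ?thesis using bounds(4) less_imp_le by blast
  qed
  have pos: "0 < ?f x y z" if "(x, y, z) \<noteq> (0, 0, 0)" for x y z
  proof (cases "(y, z) = (0, 0)")
    case True
    then have "?f x y z = A * x\<^sup>2" by (simp add: qform_def)
    then show ?thesis using A that True by simp
  next
    case False
    then have "0 < A * ?f x y z" unfolding Af using bounds(4) by (blast intro: add_nonneg_pos zero_le_power2)
    then show ?thesis using A by (simp add: zero_less_mult_iff)
  qed
  \<comment> \<open>The last two summands bound \<open>z\<close> and \<open>y\<close>; the first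
    three bound \<open>A * x\<close>, given \<open>|A * x + D * y + E * z| \<le> A\<close>.\<close>
  define K where "K = A + \<bar>D\<bar> * (\<gamma> * A) + \<bar>E\<bar> * (\<alpha> * A) + \<alpha> * A + \<gamma> * A"
  have terms: "0 \<le> \<bar>D\<bar> * (\<gamma> * A)" "0 \<le> \<bar>E\<bar> * (\<alpha> * A)" "0 \<le> \<alpha> * A" "0 \<le> \<gamma> * A"
    using A \<alpha> \<gamma> by simp_all
  have "1 \<le> K" using terms discrete[OF A] unfolding K_def by linarith
  then have one_in: "1 \<in> {-K..K}" and zero_in: "0 \<in> {-K..K}"
    unfolding atLeastAtMost_iff by linarith+
  have in_box: "x \<in> {-K..K} \<and> y \<in> {-K..K} \<and> z \<in> {-K..K}" if le: "?f x y z \<le> A" for x y z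
  proof -
    have "A * ?f x y z \<le> A * A" using le A by simp
    then have sum_le: "(A * x + D * y + E * z)\<^sup>2 + ?q y z \<le> A\<^sup>2" unfolding Af by (simp add: power2_eq_square)
    then have "?q y z \<le> A\<^sup>2" "(A * x + D * y + E * z)\<^sup>2 \<le> A\<^sup>2"
      using q_nonneg[of y z] zero_le_power2[of "A * x + D * y + E * z"] by linarith+
    have self_mult: "w * A\<^sup>2 \<le> (w * A)\<^sup>2" if "0 < w" for w
    proof -
      have "1 * (w * A\<^sup>2) \<le> w * (w * A\<^sup>2)" using that discrete[OF that] by (intro mult_right_mono) auto
      then show ?thesis by (simp add: power2_eq_square ac_simps)
    qed
    have "z\<^sup>2 \<le> (\<alpha> * A)\<^sup>2"
      using order_trans[OF bounds(2) order_trans[OF mult_left_mono[OF \<open>?q y z \<le> A\<^sup>2\<close>] self_mult]] \<alpha> by simp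
    then have z: "\<bar>z\<bar> \<le> \<alpha> * A" using terms(3) by (simp add: abs_le_square_iff[symmetric])
    have "y\<^sup>2 \<le> (\<gamma> * A)\<^sup>2"
      using order_trans[OF bounds(3) order_trans[OF mult_left_mono[OF \<open>?q y z \<le> A\<^sup>2\<close>] self_mult]] \<gamma> by simp
    then have y: "\<bar>y\<bar> \<le> \<gamma> * A" using terms(4) by (simp add: abs_le_square_iff[symmetric])
    have "\<bar>A * x + D * y + E * z\<bar> \<le> A"
      using \<open>(A * x + D * y + E * z)\<^sup>2 \<le> A\<^sup>2\<close> A by (simp add: abs_le_square_iff[symmetric])
    moreover have "\<bar>D * y\<bar> \<le> \<bar>D\<bar> * (\<gamma> * A)" "\<bar>E * z\<bar> \<le> \<bar>E\<bar> * (\<alpha> * A)"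
      unfolding abs_mult using y z by (simp_all add: mult_left_mono)
    ultimately have "\<bar>A * x\<bar> \<le> A + \<bar>D\<bar> * (\<gamma> * A) + \<bar>E\<bar> * (\<alpha> * A)" by linarith
    moreover have "1 * \<bar>x\<bar> \<le> A * \<bar>x\<bar>" using discrete[OF A] by (intro mult_right_mono) auto
    then have "\<bar>x\<bar> \<le> \<bar>A * x\<bar>" using A by (simp add: abs_mult)
    ultimately have "\<bar>x\<bar> \<le> K" "\<bar>y\<bar> \<le> K" "\<bar>z\<bar> \<le> K"
      using y z A terms unfolding K_def by linarith+
    then show ?thesis unfolding abs_le_iff atLeastAtMost_iff by (simp add: minus_le_iff[of K])
  qed
  have f100: "?f 1 0 0 = A" unfolding qform_def by simp
  then have f100_pos: "0 < ?f 1 0 0" using A by simp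
  obtain x y z where xyz: "0 < ?f x y z" and
    min: "\<And>x' y' z'. x' \<in> {-K..K} \<Longrightarrow> y' \<in> {-K..K} \<Longrightarrow> z' \<in> {-K..K} \<Longrightarrow> 0 < ?f x' y' z' \<Longrightarrow>
      ?f x y z \<le> ?f x' y' z'"
    by (rule box_minimum[OF one_in zero_in zero_in f100_pos]) blast
  have "?f x y z \<le> ?f x' y' z'" if nz: "(x', y', z') \<noteq> (0, 0, 0)" for x' y' z'
  proof (cases "?f x' y' z' \<le> A")
    case True
    then show ?thesis using in_box min pos[OF nz] by blast
  next
    case False
    then show ?thesis using min[OF one_in zero_in zero_in f100_pos] unfolding f100 by simp
  qed
  moreover have "(x, y, z) \<noteq> (0, 0, 0)"
  proof
    assume "(x, y, z) = (0, 0, 0)"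
    then show False using xyz by (simp add: qform_def)
  qed
  ultimately show ?thesis using that pos by blast
qed

text \<open>
  If \<open>q\<close> is the binary form with \<open>A f = (A x + D y + E z)\<^sup>2 + q y z\<close>, a small value of \<open>q\<close> lifts to a vector
  with \<open>A\<^sup>2 \<le> A f \<le> A\<^sup>2 / 4 + q y z\<close>.
\<close>

lemma reduced_ternary_bound:
  assumes A: "0 < (A::'a)" and det: "0 < qdet A B C D E H"
    and min: "\<And>x y z. (x, y, z) \<noteq> (0, 0, 0) \<Longrightarrow> A \<le> qform A B C D E H x y z"
  shows "27 * A ^ 3 \<le> 64 * qdet A B C D E H"
proof -
  let ?f = "qform A B C D E H" and ?d = "qdet A B C D E H"
  define \<alpha> where "\<alpha> = A * B - D\<^sup>2"
  define \<beta> where "\<beta> = A * H - D * E"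
  define \<gamma> where "\<gamma> = A * C - E\<^sup>2"
  let ?q = "\<lambda>y z. qform \<alpha> \<gamma> 0 \<beta> 0 0 y z 0"
  have Af: "A * ?f x y z = (A * x + D * y + E * z)\<^sup>2 + ?q y z" for x y z
    unfolding qform_def \<alpha>_def \<beta>_def \<gamma>_def by algebra
  \<comment> \<open>Positivity of the minor follows from the lower bound \<open>A\<close> on the
    values: the vector \<open>(- D, A, 0)\<close> has value \<open>A * \<alpha>\<close>.\<close>
  have "0 < ?f (- D) A 0" using A min[of "- D" A 0] by simp
  moreover have "?f (- D) A 0 = A * \<alpha>"
    unfolding qform_def \<alpha>_def by (simp add: power2_eq_square algebra_simps)
  ultimately have \<alpha>: "0 < \<alpha>" using A by (simp add: zero_less_mult_iff)
  have disc: "\<alpha> * \<gamma> - \<beta>\<^sup>2 = A * ?d"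
    unfolding \<alpha>_def \<beta>_def \<gamma>_def qdet_def by algebra
  then have "0 < \<alpha> * \<gamma> - \<beta>\<^sup>2" using A det by simp
  then obtain y z where yz: "(y, z) \<noteq> (0, 0)" "3 * (?q y z)\<^sup>2 \<le> 4 * (\<alpha> * \<gamma> - \<beta>\<^sup>2)" "0 < ?q y z"
    using binary_minimum[OF \<alpha>] by metis
  obtain x where x: "(2 * (D * y + E * z + A * x))\<^sup>2 \<le> A\<^sup>2" using nearest_multiple[OF A] by blast
  have "A * A \<le> A * ?f x y z" using min[of x y z] yz(1) A by simp
  then have "4 * A\<^sup>2 \<le> (2 * (D * y + E * z + A * x))\<^sup>2 + 4 * ?q y z"
    unfolding Af by (simp add: power2_eq_square algebra_simps)
  with x have "3 * A\<^sup>2 \<le> 4 * ?q y z" by linarith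
  then have "(3 * A\<^sup>2)\<^sup>2 \<le> (4 * ?q y z)\<^sup>2" by (intro power_mono) auto
  then have "9 * A ^ 4 \<le> 16 * (?q y z)\<^sup>2" by (simp add: power_mult_distrib)
  with yz(2) have "27 * A ^ 4 \<le> 64 * (A * ?d)" unfolding disc by linarith
  then have "A * (27 * A ^ 3) \<le> A * (64 * ?d)" by (simp add: power_numeral_reduce algebra_simps)
  then show ?thesis using A by simp
qed

text \<open>Two unimodular substitutions turn the primitive part of a minimizer into the first basis
  vector. The minimum becomes the leading coefficient and the determinant is unchanged.\<close>

lemma ternary_minimum:
  assumes "0 < (A::'a)" "0 < A * B - D\<^sup>2" and det: "0 < qdet A B C D E H"
  obtains x y z where "(x, y, z) \<noteq> (0, 0, 0)" "0 < qform A B C D E H x y z"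
    "27 * (qform A B C D E H x y z) ^ 3 \<le> 64 * qdet A B C D E H"
proof -
  let ?f = "qform A B C D E H"
  obtain x y z where nz: "(x, y, z) \<noteq> (0, 0, 0)" and
    min: "\<And>x' y' z'. (x', y', z') \<noteq> (0, 0, 0) \<Longrightarrow> 0 < ?f x' y' z' \<and> ?f x y z \<le> ?f x' y' z'"
    by (rule ternary_attained_minimum[OF assms]) blast
  \<comment> \<open>The minimizer is \<open>h\<close> times the primitive vector
    \<open>(p * g', q * g', r)\<close>. The first substitution moves \<open>(p, q, 0)\<close> to the
    first basis vector; the second, after exchanging the last two variables, uses
    \<open>(g', r)\<close>.\<close>
  obtain g p q u v where 1: "x = g * p" "y = g * q" "u * p + v * q = 1" using bezout[of x y] by metis
  obtain h g' r i j where 2: "g = h * g'" "z = h * r" "i * g' + j * r = 1" using bezout[of g z] by metis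
  obtain B1 D1 E1 H1 where s1: "\<And>x y z. qform (A * p\<^sup>2 + B * q\<^sup>2 + 2 * D * p * q) B1 C D1 E1 H1 x y z =
       ?f (p * x - v * y) (q * x + u * y) z"
    and d1: "qdet (A * p\<^sup>2 + B * q\<^sup>2 + 2 * D * p * q) B1 C D1 E1 H1 = qdet A B C D E H * (u * p + v * q)\<^sup>2"
    using qform_substitution[of A p B q D C E H v u] by metis
  define A1 where "A1 = A * p\<^sup>2 + B * q\<^sup>2 + 2 * D * p * q"
  define A2 where "A2 = A1 * g'\<^sup>2 + C * r\<^sup>2 + 2 * E1 * g' * r"
  obtain B2 D2 E2 H2 where s2: "\<And>x y z. qform A2 B2 B1 D2 E2 H2 x y z =
       qform A1 C B1 E1 D1 H1 (g' * x - j * y) (r * x + i * y) z"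
    and d2: "qdet A2 B2 B1 D2 E2 H2 = qdet A1 C B1 E1 D1 H1 * (i * g' + j * r)\<^sup>2"
    using qform_substitution[of A1 g' C r E1 B1 D1 H1 j i] unfolding A2_def by metis
  have f2: "qform A2 B2 B1 D2 E2 H2 x y z =
      ?f (p * (g' * x - j * y) - v * z) (q * (g' * x - j * y) + u * z) (r * x + i * y)" for x y z
    unfolding s2 qform_swap[of A1 C] unfolding A1_def s1 ..
  have d: "qdet A2 B2 B1 D2 E2 H2 = qdet A B C D E H"
    unfolding d2 qdet_swap[of A1 C] unfolding A1_def d1 using 1(3) 2(3) by simp
  have nonzero: "(p * (g' * x - j * y) - v * z, q * (g' * x - j * y) + u * z, r * x + i * y) \<noteq> (0, 0, 0)"
    if "(x, y, z) \<noteq> (0, 0, 0)" for x y z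
  proof
    assume "(p * (g' * x - j * y) - v * z, q * (g' * x - j * y) + u * z, r * x + i * y) = (0, 0, 0)"
    then have 0: "p * (g' * x - j * y) - v * z = 0" "q * (g' * x - j * y) + u * z = 0" "r * x + i * y = 0"
      by auto
    \<comment> \<open>Both substitutions have determinant 1, so the coordinates are recovered by
      inverting them in turn.\<close>
    have "z = 0" using 0(1,2) 1(3) by algebra
    moreover have "g' * x - j * y = 0" using 0(1,2) 1(3) by algebra
    then have "x = 0" "y = 0" using 0(3) 2(3) by algebra+
    ultimately show False using that by simp
  qed
  have A2: "A2 = ?f (p * g') (q * g') r" using f2[of 1 0 0] by (simp add: qform_def)
  have nz2: "(p * g', q * g', r) \<noteq> (0, 0, 0)" using nonzero[of 1 0 0] by simp
  then have "0 < A2" unfolding A2 using min by blast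
  have "?f x y z = h\<^sup>2 * A2"
    unfolding A2 qform_scale[symmetric] 1(1,2) 2(1,2) by (simp add: ac_simps)
  moreover have "h \<noteq> 0" using nz 1 2 by auto
  then have "1 \<le> h\<^sup>2" using discrete[of "h\<^sup>2"] by simp
  ultimately have "A2 \<le> ?f x y z" using \<open>0 < A2\<close> mult_right_mono[of 1 "h\<^sup>2" A2] by simp
  then have "A2 \<le> qform A2 B2 B1 D2 E2 H2 x' y' z'" if "(x', y', z') \<noteq> (0, 0, 0)" for x' y' z'
    unfolding f2 using min[OF nonzero[OF that]] by linarith
  then have "27 * A2 ^ 3 \<le> 64 * qdet A B C D E H"
    using reduced_ternary_bound[of A2 B2 B1 D2 E2 H2] \<open>0 < A2\<close> det unfolding d by blast
  then show ?thesis using that[OF nz2] \<open>0 < A2\<close> unfolding A2 by blast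
qed

end

section \<open>Legendre's equation\<close>

context IDelta0_model
begin

section \<open>The lattice argument for positive coefficients\<close>

lemma coprime_product_dvd:
  assumes "m dvd (f::'a)" "n dvd f" "u * m + v * n = 1"
  shows "m * n dvd f"
proof -
  obtain k l where "f = m * k" "f = n * l" using assms(1,2) unfolding dvd_def by blast
  then have "f = m * n * (u * l + v * k)" using assms(3) by algebra
  then show ?thesis by (rule dvdI)
qed

lemma coprime_cancel_dvd:
  assumes "m dvd n * (f::'a)" "u * m + v * n = 1"
  shows "m dvd f"
proof -
  have "f = m * (u * f) + v * (n * f)" using assms(2) by algebra
  then show ?thesis using assms(1) by (metis dvd_add dvd_mult dvd_triv_left)
qed

text \<open>Modulo \<open>c\<close>, where \<open>- a * b\<close> is the square of \<open>s\<close>,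
  multiplying by \<open>a\<close> splits the form into
  \<open>(a * x - s * y) * (a * x + s * y)\<close>; then \<open>a\<close> cancels, being
  invertible.\<close>

lemma legendre_congruence:
  assumes "c dvd (a::'a) * x - s * y" "c dvd a * b + s\<^sup>2" "u * c + v * a = 1"
  shows "c dvd a * x\<^sup>2 + b * y\<^sup>2"
proof (rule coprime_cancel_dvd[OF _ assms(3)])
  have "a * (a * x\<^sup>2 + b * y\<^sup>2) = (a * x - s * y) * (a * x + s * y) + (a * b + s\<^sup>2) * y\<^sup>2"
    by algebra
  then show "c dvd a * (a * x\<^sup>2 + b * y\<^sup>2)" using assms(1,2) by simp
qed

lemma legendre_positive:
  assumes pos: "0 < (a::'a)" "0 < b" "0 < c"
    and ab: "u1 * a + v1 * b = 1" and bc: "u2 * b + v2 * c = 1" and ac: "u3 * a + v3 * c = 1"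
    and s: "c dvd a * b + s\<^sup>2" and t: "a dvd b * - c + t\<^sup>2" and r: "b dvd a * - c + r\<^sup>2"
  shows "\<exists>x y z. (x, y, z) \<noteq> (0, 0, 0) \<and> a * x\<^sup>2 + b * y\<^sup>2 = c * z\<^sup>2"
proof -
  \<comment> \<open>Chinese remaindering: \<open>b * \<kappa>\<close> is \<open>s\<close> modulo
    \<open>c\<close>, \<open>b * y1\<close> is \<open>t\<close> modulo \<open>a\<close>, and
    \<open>a * x1\<close> is \<open>r\<close> modulo \<open>b\<close> and \<open>s * y1\<close>
    modulo \<open>c\<close>.\<close>
  define \<kappa> where "\<kappa> = u2 * s"
  define y1 where "y1 = v1 * t"
  define x1 where "x1 = u1 * r * (v2 * c) + u3 * s * y1 * (u2 * b)"
  have \<kappa>: "b * \<kappa> = s - c * (s * v2)"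
    using bc unfolding \<kappa>_def by algebra
  have y1: "b * y1 = t - a * (u1 * t)"
    using ab unfolding y1_def by algebra
  have x1_b: "a * x1 = r + b * (a * u3 * s * y1 * u2 - r * u2 - r * v1 * v2 * c)"
    using ab bc unfolding x1_def by algebra
  have x1_c: "a * x1 = s * y1 + c * (a * u1 * r * v2 - s * y1 * v2 - s * y1 * v3 * u2 * b)"
    using bc ac unfolding x1_def by algebra
  define N where "N = a * b * c"
  have N: "0 < N" unfolding N_def using pos by simp
  txt \<open>The lattice vectors in the basis \<open>(bc, 0, 0)\<close>, \<open>(b\<kappa>, a, 0)\<close>, \<open>(x1, y1, 1)\<close>.\<close>
  let ?x = "\<lambda>i j k. b * c * i + b * \<kappa> * j + x1 * k" and ?y = "\<lambda>j k. a * j + y1 * k"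
  \<comment> \<open>The Gram matrix of \<open>a * x^2 + b * y^2 + 2 * c * z^2\<close> in this
    basis.\<close>
  define A where "A = a * (b * c)\<^sup>2"
  define B where "B = a * (b * \<kappa>)\<^sup>2 + b * a\<^sup>2"
  define C where "C = a * x1\<^sup>2 + b * y1\<^sup>2 + 2 * c"
  define D where "D = a * (b * c) * (b * \<kappa>)"
  define E where "E = a * (b * c) * x1"
  define H where "H = a * (b * \<kappa>) * x1 + b * a * y1"
  note coeffs = A_def B_def C_def D_def E_def H_def
  have form: "qform A B C D E H i j k = a * (?x i j k)\<^sup>2 + b * (?y j k)\<^sup>2 + 2 * (c * k\<^sup>2)" for i j k
    unfolding coeffs qform_def by algebra
  have "A * B - D\<^sup>2 = N\<^sup>2 * (a * b)" unfolding coeffs N_def by algebra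
  then have minor: "0 < A * B - D\<^sup>2" using N pos by simp
  \<comment> \<open>The diagonal form has determinant \<open>2 * N\<close>; the basis has
    determinant \<open>b * c * a = N\<close>, which enters squared.\<close>
  have det: "qdet A B C D E H = 2 * N ^ 3" unfolding coeffs N_def qdet_def by algebra
  have "0 < A" unfolding A_def using pos by simp
  then obtain i j k where ijk: "(i, j, k) \<noteq> (0, 0, 0)" "0 < qform A B C D E H i j k"
    "27 * (qform A B C D E H i j k) ^ 3 \<le> 64 * qdet A B C D E H"
    using ternary_minimum minor det N by (metis zero_less_mult_iff zero_less_numeral zero_less_power)
  define x where "x = ?x i j k"
  define y where "y = ?y j k"
  define m where "m = a * x\<^sup>2 + b * y\<^sup>2 + 2 * (c * k\<^sup>2)"
  have m_le: "27 * m ^ 3 \<le> 128 * N ^ 3" using ijk(3) unfolding det form m_def x_def y_def by simp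
  \<comment> \<open>Hermite's constant suffices because \<open>128 / 27 < 8\<close>.\<close>
  have "m < 2 * N"
  proof (rule ccontr)
    assume "\<not> m < 2 * N"
    then have "(2 * N) ^ 3 \<le> m ^ 3" using N by (intro power_mono) auto
    then have "8 * N ^ 3 \<le> m ^ 3" by (simp add: power_mult_distrib)
    moreover have "0 < N ^ 3" using N by simp
    ultimately show False using m_le by linarith
  qed
  have nz: "(x, y, k) \<noteq> (0, 0, 0)"
  proof
    assume "(x, y, k) = (0, 0, 0)"
    then have "k = 0" "a * j = 0" "b * c * i + b * \<kappa> * j = 0" unfolding x_def y_def by auto
    then show False using ijk(1) pos by auto
  qed
  define f where "f = a * x\<^sup>2 + b * y\<^sup>2 - c * k\<^sup>2"
  have "a * x - s * y = c * (a * b * i - a * s * v2 * j + (a * u1 * r * v2 - s * y1 * v2 - s * y1 * v3 * u2 * b) * k)"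
    using \<kappa> x1_c unfolding x_def y_def by algebra
  then have "c dvd a * x - s * y" by (rule dvdI)
  moreover have "v3 * c + u3 * a = 1" using ac by (simp add: add.commute)
  ultimately have "c dvd a * x\<^sup>2 + b * y\<^sup>2" using s legendre_congruence by blast
  then have c_dvd: "c dvd f" unfolding f_def by simp
  have "b * y - t * k = a * (b * j - u1 * t * k)"
    using y1 unfolding y_def by algebra
  then have "a dvd b * y - t * k" by (rule dvdI)
  then have "a dvd b * y\<^sup>2 + - c * k\<^sup>2" using t ab legendre_congruence by blast
  moreover have "f = a * x\<^sup>2 + (b * y\<^sup>2 + - c * k\<^sup>2)" unfolding f_def by simp
  ultimately have a_dvd: "a dvd f" by simp
  have "a * x - r * k = b * (a * c * i + a * \<kappa> * j + (a * u3 * s * y1 * u2 - r * u2 - r * v1 * v2 * c) * k)"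
    using x1_b unfolding x_def by algebra
  then have "b dvd a * x - r * k" by (rule dvdI)
  moreover have "v1 * b + u1 * a = 1" using ab by (simp add: add.commute)
  ultimately have "b dvd a * x\<^sup>2 + - c * k\<^sup>2" using r legendre_congruence by blast
  moreover have "f = b * y\<^sup>2 + (a * x\<^sup>2 + - c * k\<^sup>2)" unfolding f_def by simp
  ultimately have b_dvd: "b dvd f" by simp
  have "u3 * u2 * (a * b) + (u3 * a * v2 + v3) * c = u3 * a * (u2 * b + v2 * c) + v3 * c"
    by (simp add: algebra_simps)
  also have "\<dots> = 1" using bc ac by simp
  finally have "N dvd f"
    unfolding N_def by (rule coprime_product_dvd[OF coprime_product_dvd[OF a_dvd b_dvd ab] c_dvd])
  then obtain g where g: "f = N * g" by (rule dvdE)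
  have nonneg: "0 \<le> a * x\<^sup>2" "0 \<le> b * y\<^sup>2" "0 \<le> c * k\<^sup>2" using pos by simp_all
  \<comment> \<open>The weight 2 on \<open>c * k^2\<close> gives the lower bound:
    \<open>2 * c * k^2 \<le> m < 2 * N\<close>, hence
    \<open>f \<ge> - (c * k^2) > - N\<close>.\<close>
  then have "f < N * 2" "N * - 1 < f" using \<open>m < 2 * N\<close> unfolding m_def f_def by linarith+
  then have "g < 2" "- 1 < g" using mult_less_cancel_left_pos[OF N] unfolding g by blast+
  then have "0 \<le> g" "g \<le> 1" using less_iff_add_one_le[of "- 1" g] less_iff_add_one_le[of g 2] by auto
  then have "g = 0 \<or> g = 1" using discrete[of g] by force
  then show ?thesis
  proof
    assume "g = 0"
    then have "a * x\<^sup>2 + b * y\<^sup>2 = c * k\<^sup>2" using g unfolding f_def by simp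
    then show ?thesis using nz by blast
  next
    assume "g = 1"
    then have "a * x\<^sup>2 + b * y\<^sup>2 - c * k\<^sup>2 = a * b * c" using g unfolding f_def N_def by simp
    \<comment> \<open>The left side is \<open>(k^2 + a * b) * (a * x^2 + b * y^2)\<close>, whose
      second factor equals \<open>c * (k^2 + a * b)\<close>.\<close>
    then have "a * (x * k + b * y)\<^sup>2 + b * (y * k - a * x)\<^sup>2 = c * (k\<^sup>2 + a * b)\<^sup>2" by algebra
    moreover have "k\<^sup>2 + a * b \<noteq> 0" using pos by (simp add: add_nonneg_pos less_imp_neq[symmetric])
    ultimately show ?thesis by blast
  qed
qed

section \<open>Coprimality and primes\<close>

lemma relatively_prime_bezout:
  assumes "relatively_prime a b" "(a::'a) \<noteq> 0"
  obtains u v where "u * a + v * b = 1"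
proof -
  obtain g p q u v where g: "a = g * p" "b = g * q" "u * p + v * q = 1" using bezout[of a b] by metis
  have le: "d \<le> 1" if "d dvd a" "d dvd b" for d
    using assms(1) that unfolding relatively_prime_def is_greatest_common_divisor_def by blast
  have "g \<noteq> 0" using g(1) assms(2) by auto
  moreover have "\<bar>g\<bar> \<le> 1" using le[of "\<bar>g\<bar>"] g(1,2) by simp
  ultimately have "\<bar>g\<bar> = 1" using discrete[of "\<bar>g\<bar>"] by (intro antisym) auto
  then have "g * g = 1" by (metis abs_mult_self_eq mult_1)
  then have "(g * u) * a + (g * v) * b = 1" using g by algebra
  then show ?thesis using that by blast
qed

text \<open>The least divisor of \<open>\<bar>n\<bar>\<close> above 1 is prime, since its divisors
  divide \<open>n\<close> as well. Bounding the complementary factor by \<open>\<bar>n\<bar>\<close>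
  keeps the condition bounded.\<close>

lemma prime_divisor:
  assumes "1 < \<bar>n::'a\<bar>"
  obtains p where "prime_elem_of p" "p dvd n"
proof -
  define n' where "n' = \<bar>n\<bar>"
  have n': "1 < n'" using assms unfolding n'_def .
  have "definable (\<lambda>e::nat \<Rightarrow> 'a. e 0 * e 4 = e 2)"
    by (intro definable_eq ring_term_intros)
  from definable_bex[OF this, of 4 2]
  have def: "definable (\<lambda>e::nat \<Rightarrow> 'a. 1 < e 0 \<and> (\<exists>k\<in>{0..e 2}. e 0 * k = e 2))" (is "definable ?P")
    by (intro definable_conj definable_less ring_term_intros) simp
  let ?e = "(\<lambda>_. 0)(2 := n')"
  let ?Q = "\<lambda>d. 1 < d \<and> (\<exists>k\<in>{0..n'}. d * k = n')"
  have fresh: "?P (e(1 := x)) \<longleftrightarrow> ?P e" for e x by simp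
  have nonneg: "0 \<le> ?e i" for i using n' by simp
  have P_iff_Q: "?P (?e(0 := d)) \<longleftrightarrow> ?Q d" for d by simp
  have "1 \<in> {0..n'}" "n' * 1 = n'" using n' by auto
  then have "?Q n'" using n' by blast
  have "0 \<le> n'" using n' by simp
  have "\<exists>p\<ge>0. ?Q p \<and> (\<forall>y\<ge>0. y < p \<longrightarrow> \<not> ?Q y)"
    by (rule least_number[where P = ?P and e = ?e and Q = ?Q,
          OF def fresh nonneg P_iff_Q \<open>0 \<le> n'\<close> \<open>?Q n'\<close>])
  then obtain p where p: "1 < p" "p dvd n'" and min: "\<And>y. 0 \<le> y \<Longrightarrow> y < p \<Longrightarrow> \<not> ?Q y"
    unfolding dvd_def by metis
  have "d = 1 \<or> d = p" if d: "0 < d" "d dvd p" for d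
  proof (rule ccontr)
    assume ne: "\<not> (d = 1 \<or> d = p)"
    obtain l where l: "p = d * l" using d(2) by (rule dvdE)
    have "0 < l" using p(1) d(1) l by (metis less_trans zero_less_mult_pos zero_less_one)
    then have "d * 1 \<le> d * l" using d(1) discrete by (intro mult_left_mono) auto
    then have "d \<le> p" using l by simp
    then have "d < p" using ne by simp
    have "1 < d" using discrete[OF d(1)] ne by auto
    obtain k where k: "n' = d * k" using d(2) p(2) dvd_trans by (blast elim: dvdE)
    then have "0 < k" using n' d(1) by (metis less_trans zero_less_mult_pos zero_less_one)
    then have "1 * k \<le> d * k" using \<open>1 < d\<close> by (intro mult_right_mono) auto
    then have "k \<in> {0..n'}" using \<open>0 < k\<close> k by simp
    then show False using min[of d] \<open>d < p\<close> \<open>1 < d\<close> k d(1) by (metis less_imp_le)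
  qed
  then have "prime_elem_of p" unfolding prime_elem_of_def using p(1) by blast
  then show ?thesis using that p(2) unfolding n'_def by simp
qed

lemma prime_dvd_or_coprime:
  assumes "prime_elem_of (p::'a)"
  obtains "p dvd x" | u v where "u * p + v * x = 1"
proof -
  have p: "1 < p" "\<And>d. 0 < d \<Longrightarrow> d dvd p \<Longrightarrow> d = 1 \<or> d = p"
    using assms unfolding prime_elem_of_def by blast+
  obtain g k l u v where g: "p = g * k" "x = g * l" "u * k + v * l = 1" using bezout[of p x] by metis
  have "g \<noteq> 0" using g(1) p(1) by auto
  then consider "\<bar>g\<bar> = p" | "\<bar>g\<bar> = 1" using p(2)[of "\<bar>g\<bar>"] g(1) by auto
  then show ?thesis
  proof cases
    case 1
    then have "p dvd x" using g(2) by (metis abs_dvd_iff dvd_triv_left)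
    then show ?thesis by (rule that(1))
  next
    case 2
    then have "g * g = 1" by (metis abs_mult_self_eq mult_1)
    then have "(g * u) * p + (g * v) * x = 1" using g by algebra
    then show ?thesis by (rule that(2))
  qed
qed

lemma prime_dvd_square:
  assumes "prime_elem_of (p::'a)" "p dvd x\<^sup>2"
  shows "p dvd x"
  using assms(1)
proof (cases rule: prime_dvd_or_coprime[where x = x])
  case (2 u v)
  then show ?thesis using coprime_cancel_dvd assms(2) unfolding power2_eq_square by blast
qed

section \<open>Necessity of the residue conditions\<close>

text \<open>Modulo \<open>c\<close>, \<open>(a * x)^2\<close> equals \<open>- a * b * y^2\<close>,
  so it suffices to invert \<open>y\<close>. A prime dividing \<open>c\<close> and \<open>y\<close>
  would divide \<open>x\<close>, so its square would divide \<open>c * z^2\<close>; primitivity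
  excludes \<open>z\<close> and square-freeness excludes \<open>c\<close>.\<close>

lemma legendre_necessary:
  assumes "(c::'a) \<noteq> 0" "square_free c" and ac: "u1 * a + v1 * c = 1" and bc: "u2 * b + v2 * c = 1"
    and sol: "a * x\<^sup>2 + b * y\<^sup>2 + c * z\<^sup>2 = 0" and prim: "u3 * x + v3 * y + w3 * z = 1"
  shows "(- (a * b)) \<R> c"
proof -
  obtain g k l u v where g: "c = g * k" "y = g * l" "u * k + v * l = 1" using bezout[of c y] by metis
  have "g \<noteq> 0" using g(1) assms(1) by auto
  have "\<not> 1 < \<bar>g\<bar>"
  proof
    assume "1 < \<bar>g\<bar>"
    then obtain p where p: "prime_elem_of p" "p dvd g" by (rule prime_divisor)
    have "p dvd c" "p dvd y" using p(2) g(1,2) by simp_all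
    then obtain c' y' where c': "c = p * c'" and y': "y = p * y'" by (blast elim: dvdE)
    have "x\<^sup>2 = p * (v1 * c' * x\<^sup>2 - u1 * (b * p * y'\<^sup>2 + c' * z\<^sup>2))"
      using ac sol unfolding c' y' by algebra
    then have "p dvd x\<^sup>2" by (rule dvdI)
    then have "p dvd x" using prime_dvd_square p(1) by blast
    then obtain x' where x': "x = p * x'" by (rule dvdE)
    from p(1) show False
    proof (cases rule: prime_dvd_or_coprime[where x = z])
      case 1
      then obtain z' where "z = p * z'" by (rule dvdE)
      then have "p * (u3 * x' + v3 * y' + w3 * z') = 1" using prim unfolding x' y' by (simp add: algebra_simps)
      moreover have "1 < p" using p(1) unfolding prime_elem_of_def by blast
      moreover have "p * w \<noteq> 1" if "1 < p" for w
      proof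
        assume w: "p * w = 1"
        then have "0 < w" using that by (metis less_trans zero_less_mult_pos zero_less_one)
        then have "p * 1 \<le> p * w" using that discrete by (intro mult_left_mono) auto
        then show False using w that by simp
      qed
      ultimately show False by blast
    next
      case (2 \<alpha> \<beta>)
      \<comment> \<open>The relation \<open>\<alpha> * p + \<beta> * z = 1\<close> gives
        \<open>1 = \<alpha> * p * (1 + \<beta> * z) + \<beta>^2 * z^2\<close>; after multiplication
        by \<open>c\<close> both summands contain \<open>p^2\<close>.\<close>
      have "c = p\<^sup>2 * (c' * \<alpha> * (1 + \<beta> * z) - \<beta>\<^sup>2 * (a * x'\<^sup>2 + b * y'\<^sup>2))"
        using 2 sol unfolding c' x' y' by algebra
      then have "p\<^sup>2 dvd c" by (rule dvdI)
      then show False using assms(2) p(1) unfolding square_free_def by blast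
    qed
  qed
  then have "\<bar>g\<bar> = 1" using \<open>g \<noteq> 0\<close> discrete[of "\<bar>g\<bar>"] by (intro antisym) auto
  then have "g * g = 1" by (metis abs_mult_self_eq mult_1)
  then have inv: "(g * u) * c + (g * v) * y = 1" using g by algebra
  \<comment> \<open>By \<open>inv\<close>, \<open>g * v\<close> is an inverse of \<open>y\<close>
    modulo \<open>c\<close>, so the square root is \<open>a * x / y\<close>.\<close>
  have "- (a * b) - (a * x * (g * v))\<^sup>2 =
      c * (a * (g * v)\<^sup>2 * z\<^sup>2 - a * b * (g * u) * (1 + (g * v) * y))"
    using inv sol by algebra
  then have "c dvd - (a * b) - (a * x * (g * v))\<^sup>2" by (rule dvdI)
  then show ?thesis unfolding square_modulo_def by blast
qed

text \<open>By homogeneity the greatest common divisor \<open>h\<close> of the coordinates can be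
  divided out.\<close>

lemma primitive_solution:
  assumes "(x, y, z) \<noteq> (0, 0, 0::'a)" "a * x\<^sup>2 + b * y\<^sup>2 + c * z\<^sup>2 = 0"
  obtains x y z u v w where "a * x\<^sup>2 + b * y\<^sup>2 + c * z\<^sup>2 = 0" "u * x + v * y + w * z = 1"
proof -
  obtain g p q u v where 1: "x = g * p" "y = g * q" "u * p + v * q = 1" using bezout[of x y] by metis
  obtain h g' r i j where 2: "g = h * g'" "z = h * r" "i * g' + j * r = 1" using bezout[of g z] by metis
  have "h \<noteq> 0" using assms(1) 1 2 by auto
  have "h\<^sup>2 * (a * (p * g')\<^sup>2 + b * (q * g')\<^sup>2 + c * r\<^sup>2) = 0"
    using assms(2) unfolding 1(1,2) 2(1,2) by algebra
  then have "a * (p * g')\<^sup>2 + b * (q * g')\<^sup>2 + c * r\<^sup>2 = 0" using \<open>h \<noteq> 0\<close> by simp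
  moreover have "(i * u) * (p * g') + (i * v) * (q * g') + j * r = 1" using 1(3) 2(3) by algebra
  ultimately show ?thesis by (rule that)
qed

section \<open>Sign patterns and permutations of the coefficients\<close>

text \<open>Reduction to \<open>legendre_positive\<close> by replacing \<open>c\<close> with
  \<open>- c\<close>, or \<open>a, b\<close> with \<open>- a, - b\<close>; the congruences survive,
  since divisibility ignores signs.\<close>

lemma legendre_sufficient:
  assumes signs: "sgn a = sgn b" "sgn b \<noteq> sgn c" and nz: "(a::'a) \<noteq> 0" "b \<noteq> 0" "c \<noteq> 0"
    and ab: "u1 * a + v1 * b = 1" and bc: "u2 * b + v2 * c = 1" and ac: "u3 * a + v3 * c = 1"
    and squares: "(- (a * b)) \<R> c" "(- (b * c)) \<R> a" "(- (a * c)) \<R> b"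
  shows "\<exists>x y z. (x, y, z) \<noteq> (0, 0, 0) \<and> a * x\<^sup>2 + b * y\<^sup>2 + c * z\<^sup>2 = 0"
proof -
  obtain s t r where "c dvd - (a * b) - s\<^sup>2" "a dvd - (b * c) - t\<^sup>2" "b dvd - (a * c) - r\<^sup>2"
    using squares unfolding square_modulo_def by blast
  then have dvd: "c dvd - (- (a * b) - s\<^sup>2)" "a dvd - (- (b * c) - t\<^sup>2)" "b dvd - (- (a * c) - r\<^sup>2)"
    by (simp_all only: dvd_minus_iff)
  consider "0 < a" "0 < b" "c < 0" | "a < 0" "b < 0" "0 < c"
    using signs nz by (auto simp: sgn_if split: if_splits)
  then show ?thesis
  proof cases
    case 1
    have "u2 * b + - v2 * - c = 1" "u3 * a + - v3 * - c = 1" using bc ac by simp_all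
    moreover have "- c dvd a * b + s\<^sup>2" "a dvd b * - (- c) + t\<^sup>2" "b dvd a * - (- c) + r\<^sup>2"
      using dvd by (simp_all add: add.commute)
    moreover have "0 < - c" using 1 by simp
    ultimately obtain x y z where "(x, y, z) \<noteq> (0, 0, 0)" and sol: "a * x\<^sup>2 + b * y\<^sup>2 = - c * z\<^sup>2"
      using legendre_positive[OF 1(1,2)] ab by blast
    moreover have "a * x\<^sup>2 + b * y\<^sup>2 + c * z\<^sup>2 = 0" using sol by algebra
    ultimately show ?thesis by blast
  next
    case 2
    have "- u1 * - a + - v1 * - b = 1" "- u2 * - b + v2 * c = 1" "- u3 * - a + v3 * c = 1"
      using ab bc ac by simp_all
    moreover have "c dvd - a * - b + s\<^sup>2" "- a dvd - b * - c + t\<^sup>2" "- b dvd - a * - c + r\<^sup>2"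
      using dvd by (simp_all add: add.commute)
    moreover have "0 < - a" "0 < - b" using 2 by simp_all
    ultimately obtain x y z where "(x, y, z) \<noteq> (0, 0, 0)" and sol: "- a * x\<^sup>2 + - b * y\<^sup>2 = c * z\<^sup>2"
      using legendre_positive[OF _ _ 2(3)] by blast
    moreover have "a * x\<^sup>2 + b * y\<^sup>2 + c * z\<^sup>2 = 0" using sol by algebra
    ultimately show ?thesis by blast
  qed
qed

end

theorem theorem2p1:
  fixes a b c :: "'a::linordered_idom"
  assumes "models_IDelta0 TYPE('a)" and "Omega1 TYPE('a)"
    and "a \<noteq> 0" and "b \<noteq> 0" and "c \<noteq> 0"
    and "\<not> (sgn a = sgn b \<and> sgn b = sgn c)"
    and "square_free a" and "square_free b" and "square_free c"
    and "relatively_prime a b" and "relatively_prime b c" and "relatively_prime a c"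
  shows "(\<exists>x y z. (x, y, z) \<noteq> (0, 0, 0) \<and> a * x ^ 2 + b * y ^ 2 + c * z ^ 2 = 0) \<longleftrightarrow>
         (- (a * b)) \<R> c \<and> (- (b * c)) \<R> a \<and> (- (a * c)) \<R> b"
    (is "?solvable \<longleftrightarrow> ?squares")
proof -
  interpret IDelta0_model "TYPE('a)" by unfold_locales (rule assms(1))
  obtain u1 v1 where ab: "u1 * a + v1 * b = 1" using relatively_prime_bezout assms by blast
  obtain u2 v2 where bc: "u2 * b + v2 * c = 1" using relatively_prime_bezout assms by blast
  obtain u3 v3 where ac: "u3 * a + v3 * c = 1" using relatively_prime_bezout assms by blast
  have ba: "v1 * b + u1 * a = 1" and cb: "v2 * c + u2 * b = 1" and ca: "v3 * c + u3 * a = 1"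
    using ab bc ac by (simp_all add: add.commute)
  show ?thesis
  proof
    assume ?solvable
    then obtain x y z u v w where sol: "a * x\<^sup>2 + b * y\<^sup>2 + c * z\<^sup>2 = 0" and prim: "u * x + v * y + w * z = 1"
      using primitive_solution by metis
    have "(- (a * b)) \<R> c" by (rule legendre_necessary[OF assms(5,9) ac bc sol prim])
    moreover have "(- (b * c)) \<R> a"
      by (rule legendre_necessary[OF assms(3,7) ba ca, of y z x v w u]) (use sol prim in \<open>simp_all add: ac_simps\<close>)
    moreover have "(- (a * c)) \<R> b"
      by (rule legendre_necessary[OF assms(4,8) ab cb, of x z y u w v]) (use sol prim in \<open>simp_all add: ac_simps\<close>)
    ultimately show ?squares by blast
  next
    assume squares: ?squares
    have signs: "sgn w = 1 \<or> sgn w = - 1" if "w \<noteq> 0" for w :: 'a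
      using that by (simp add: sgn_if)
    have swap: "c * b = b * c" "c * a = a * c" "b * a = a * b" by (simp_all add: mult.commute)
    \<comment> \<open>There are only two signs, so exactly one coefficient differs from the other
      two; it is moved to the third place.\<close>
    consider "sgn a = sgn b" "sgn b \<noteq> sgn c" | "sgn b = sgn c" "sgn c \<noteq> sgn a" | "sgn a = sgn c" "sgn c \<noteq> sgn b"
      using signs[OF assms(3)] signs[OF assms(4)] signs[OF assms(5)] assms(6) by metis
    then show ?solvable
    proof cases
      case 1
      then show ?thesis using legendre_sufficient[OF 1 assms(3-5) ab bc ac] squares by blast
    next
      case 2
      have "\<exists>x y z. (x, y, z) \<noteq> (0, 0, 0) \<and> b * x\<^sup>2 + c * y\<^sup>2 + a * z\<^sup>2 = 0"
        using legendre_sufficient[OF 2 assms(4,5,3) bc ca ba] squares unfolding swap by blast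
      then obtain x y z where "(x, y, z) \<noteq> (0, 0, 0)" "b * x\<^sup>2 + c * y\<^sup>2 + a * z\<^sup>2 = 0" by blast
      then show ?thesis by (intro exI[of _ z] exI[of _ x] exI[of _ y]) (auto simp: ac_simps)
    next
      case 3
      have "\<exists>x y z. (x, y, z) \<noteq> (0, 0, 0) \<and> a * x\<^sup>2 + c * y\<^sup>2 + b * z\<^sup>2 = 0"
        using legendre_sufficient[OF 3 assms(3,5,4) ac cb ab] squares unfolding swap by blast
      then obtain x y z where "(x, y, z) \<noteq> (0, 0, 0)" "a * x\<^sup>2 + c * y\<^sup>2 + b * z\<^sup>2 = 0" by blast
      then show ?thesis by (intro exI[of _ x] exI[of _ z] exI[of _ y]) (auto simp: ac_simps)
    qed
  qed
qed

end
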